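(* Let $G$ be a virtually compact special group, and let $|\cdot|$ denote word length in $G$ with respect to a fixed finite generating set. There exist constants $K,C$ and a positive integer $N$ such that if $a,b\in G$ are infinite order elements which are conjugate in $G$, then there exists $g\in G$ with $ga^N=b^Ng$ and $$|g|\leq K(|a|+|b|)+C.$$
   Context: A compact special group is the fundamental group of a compact cube complex which is special in the sense of Haglund–Wise. A group is virtually compact special if it has a finite index subgroup which is a compact special group. *)

theory Defs
  imports "HOL-Algebra.Multiplicative_Group" "HOL-Algebra.Generated_Groups"
begin

section \<open>Faces of the standard cube\<close>

text \<open>
  An isometric embedding of the standard \<open>m\<close>-cube onto an \<open>m\<close>-dimensional face of the standard
  \<open>n\<close>-cube is encoded by the list of length \<open>n\<close> of the coordinates of the image of a point
  \<open>x\<close>: the entry \<open>Const b\<close> stands for the constant coordinate \<open>b\<close> (\<open>False\<close> is 0 and \<open>True\<close> is 1),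
  \<open>Coord j False\<close> for \<open>x_j\<close> and \<open>Coord j True\<close> for \<open>1 - x_j\<close>.  Every coordinate of the source
  occurs exactly once.  For \<open>m = n\<close> these are the symmetries of the \<open>n\<close>-cube.
\<close>

datatype coord = Const bool | Coord nat bool

fun coord_indices :: "coord list \<Rightarrow> nat list" where
  "coord_indices [] = []"
| "coord_indices (Const b # e) = coord_indices e"
| "coord_indices (Coord j s # e) = j # coord_indices e"

definition face_embedding :: "nat \<Rightarrow> nat \<Rightarrow> coord list \<Rightarrow> bool" where
  "face_embedding m n e \<longleftrightarrow>
     length e = n \<and> distinct (coord_indices e) \<and> set (coord_indices e) = {..<m}"

definition id_embedding :: "nat \<Rightarrow> coord list" where
  "id_embedding n = map (\<lambda>i. Coord i False) [0..<n]"

fun reflect_coord :: "bool \<Rightarrow> coord \<Rightarrow> coord" where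
  "reflect_coord s (Const b) = Const (b \<noteq> s)"
| "reflect_coord s (Coord j t) = Coord j (t \<noteq> s)"

fun subst_coord :: "coord list \<Rightarrow> coord \<Rightarrow> coord" where
  "subst_coord e' (Const b) = Const b"
| "subst_coord e' (Coord j s) = reflect_coord s (e' ! j)"

text \<open>\<open>comp_embedding e e'\<close> is \<open>e\<close> after \<open>e'\<close>.\<close>

definition comp_embedding :: "coord list \<Rightarrow> coord list \<Rightarrow> coord list" where
  "comp_embedding e e' = map (subst_coord e') e"


section \<open>Cube complexes\<close>

text \<open>
  A cube complex is a CW complex obtained by gluing standard cubes along isometries of their faces.
  It is given here by the set of its parametrised cubes: an element of \<open>cubes X\<close> of dimension \<open>n\<close>
  is an \<open>n\<close>-cell together with one of its \<open>2^n * n!\<close> isometric parametrisations by the standard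
  \<open>n\<close>-cube, and \<open>restr X q e\<close> is the parametrised cube obtained from \<open>q\<close> by precomposition with the
  face embedding \<open>e\<close>.  The cells are the orbits under the cube symmetries.  These act freely, because
  the interior of a cell embeds in the complex.  The boundary of a cell need not embed.

  In particular the parametrised 1-cubes are the oriented edges of the complex, and a parametrised
  2-cube is a square with a chosen corner and an order of the two sides at that corner.
\<close>

record 'q cube_complex =
  cubes :: "'q set"
  cdim :: "'q \<Rightarrow> nat"
  restr :: "'q \<Rightarrow> coord list \<Rightarrow> 'q"

definition cube_complex :: "'q cube_complex \<Rightarrow> bool" where
  "cube_complex X \<longleftrightarrow>
     (\<forall>q\<in>cubes X. \<forall>m e. face_embedding m (cdim X q) e \<longrightarrow>
        restr X q e \<in> cubes X \<and> cdim X (restr X q e) = m) \<and>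
     (\<forall>q\<in>cubes X. restr X q (id_embedding (cdim X q)) = q) \<and>
     (\<forall>q\<in>cubes X. \<forall>l m e e'. face_embedding m (cdim X q) e \<longrightarrow> face_embedding l m e' \<longrightarrow>
        restr X (restr X q e) e' = restr X q (comp_embedding e e')) \<and>
     (\<forall>q\<in>cubes X. \<forall>e. face_embedding (cdim X q) (cdim X q) e \<longrightarrow> restr X q e = q \<longrightarrow>
        e = id_embedding (cdim X q))"

definition vertices :: "'q cube_complex \<Rightarrow> 'q set" where
  "vertices X = {q \<in> cubes X. cdim X q = 0}"

definition oriented_edges :: "'q cube_complex \<Rightarrow> 'q set" where
  "oriented_edges X = {q \<in> cubes X. cdim X q = 1}"

definition squares :: "'q cube_complex \<Rightarrow> 'q set" where
  "squares X = {q \<in> cubes X. cdim X q = 2}"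

definition src :: "'q cube_complex \<Rightarrow> 'q \<Rightarrow> 'q" where
  "src X a = restr X a [Const False]"

definition tgt :: "'q cube_complex \<Rightarrow> 'q \<Rightarrow> 'q" where
  "tgt X a = restr X a [Const True]"

definition rev_edge :: "'q cube_complex \<Rightarrow> 'q \<Rightarrow> 'q" where
  "rev_edge X a = restr X a [Coord 0 True]"

text \<open>
  The sides of the unit square: \<open>bottom_side\<close> and \<open>top_side\<close> are oriented from left to right,
  \<open>left_side\<close> and \<open>right_side\<close> from bottom to top.
\<close>

definition bottom_side :: "'q cube_complex \<Rightarrow> 'q \<Rightarrow> 'q" where
  "bottom_side X q = restr X q [Coord 0 False, Const False]"

definition top_side :: "'q cube_complex \<Rightarrow> 'q \<Rightarrow> 'q" where
  "top_side X q = restr X q [Coord 0 False, Const True]"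

definition left_side :: "'q cube_complex \<Rightarrow> 'q \<Rightarrow> 'q" where
  "left_side X q = restr X q [Const False, Coord 0 False]"

definition right_side :: "'q cube_complex \<Rightarrow> 'q \<Rightarrow> 'q" where
  "right_side X q = restr X q [Const True, Coord 0 False]"

text \<open>A cube complex is compact iff it has finitely many cells.\<close>

definition compact_complex :: "'q cube_complex \<Rightarrow> bool" where
  "compact_complex X \<longleftrightarrow> finite (cubes X)"


section \<open>Links and nonpositive curvature\<close>

definition origin :: "'q cube_complex \<Rightarrow> 'q \<Rightarrow> 'q" where
  "origin X q = restr X q (replicate (cdim X q) (Const False))"

definition corner_edges :: "'q cube_complex \<Rightarrow> 'q \<Rightarrow> 'q list" where
  "corner_edges X q =
     map (\<lambda>i. restr X q ((replicate (cdim X q) (Const False))[i := Coord 0 False])) [0..<cdim X q]"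

text \<open>
  The link of a vertex \<open>v\<close> has as vertices the oriented edges issuing from \<open>v\<close>, and the corners at
  \<open>v\<close> of the cubes of the complex as simplices: a parametrised cube \<open>q\<close> with origin \<open>v\<close> is a simplex
  with ordered vertex list \<open>corner_edges X q\<close>.  The link is a simplicial complex iff the vertices of
  every simplex are distinct and a simplex is determined by its vertices.  It is a flag complex iff
  moreover any finite set of pairwise adjacent vertices spans a simplex.
\<close>

definition adjacent_in_link :: "'q cube_complex \<Rightarrow> 'q \<Rightarrow> 'q \<Rightarrow> bool" where
  "adjacent_in_link X a b \<longleftrightarrow> (\<exists>q\<in>squares X. corner_edges X q = [a, b])"

definition simplicial_link :: "'q cube_complex \<Rightarrow> 'q \<Rightarrow> bool" where
  "simplicial_link X v \<longleftrightarrow>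
     (\<forall>q\<in>cubes X. origin X q = v \<longrightarrow> distinct (corner_edges X q)) \<and>
     (\<forall>q\<in>cubes X. \<forall>q'\<in>cubes X. origin X q = v \<longrightarrow> origin X q' = v \<longrightarrow>
        corner_edges X q = corner_edges X q' \<longrightarrow> q = q')"

definition flag_link :: "'q cube_complex \<Rightarrow> 'q \<Rightarrow> bool" where
  "flag_link X v \<longleftrightarrow>
     (\<forall>as. set as \<subseteq> {a \<in> oriented_edges X. src X a = v} \<longrightarrow> distinct as \<longrightarrow>
        (\<forall>a\<in>set as. \<forall>b\<in>set as. a \<noteq> b \<longrightarrow> adjacent_in_link X a b) \<longrightarrow>
        (\<exists>q\<in>cubes X. origin X q = v \<and> corner_edges X q = as))"

definition nonpositively_curved :: "'q cube_complex \<Rightarrow> bool" where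
  "nonpositively_curved X \<longleftrightarrow> (\<forall>v\<in>vertices X. simplicial_link X v \<and> flag_link X v)"


section \<open>Hyperplanes and special cube complexes\<close>

inductive parallel :: "'q cube_complex \<Rightarrow> 'q \<Rightarrow> 'q \<Rightarrow> bool" for X where
  refl: "a \<in> oriented_edges X \<Longrightarrow> parallel X a a"
| opposite: "q \<in> squares X \<Longrightarrow> parallel X (bottom_side X q) (top_side X q)"
| sym: "parallel X a b \<Longrightarrow> parallel X b a"
| trans: "parallel X a b \<Longrightarrow> parallel X b c \<Longrightarrow> parallel X a c"

text \<open>
  A hyperplane is represented by the set of the oriented edges (with both orientations) dual to it.
\<close>

definition hyperplane :: "'q cube_complex \<Rightarrow> 'q \<Rightarrow> 'q set" where
  "hyperplane X a = {b. parallel X a b \<or> parallel X (rev_edge X a) b}"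

definition hyperplanes :: "'q cube_complex \<Rightarrow> 'q set set" where
  "hyperplanes X = hyperplane X ` oriented_edges X"

definition hyperplanes_cross :: "'q cube_complex \<Rightarrow> 'q set \<Rightarrow> 'q set \<Rightarrow> bool" where
  "hyperplanes_cross X H H' \<longleftrightarrow>
     (\<exists>q\<in>squares X. bottom_side X q \<in> H \<and> left_side X q \<in> H')"

definition two_sided :: "'q cube_complex \<Rightarrow> 'q set \<Rightarrow> bool" where
  "two_sided X H \<longleftrightarrow> (\<forall>a\<in>H. \<not> parallel X a (rev_edge X a))"

text \<open>
  Two distinct oriented edges osculate if they issue from the same vertex but are not the two sides
  of a square at a corner of that square.  A self-osculation of a two-sided hyperplane is direct if
  the two edges can be chosen parallel as oriented edges; reversing both edges covers the case of a
  common terminal vertex.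
\<close>

definition edges_osculate :: "'q cube_complex \<Rightarrow> 'q \<Rightarrow> 'q \<Rightarrow> bool" where
  "edges_osculate X a b \<longleftrightarrow> a \<noteq> b \<and> src X a = src X b \<and> \<not> adjacent_in_link X a b"

definition directly_self_osculates :: "'q cube_complex \<Rightarrow> 'q set \<Rightarrow> bool" where
  "directly_self_osculates X H \<longleftrightarrow> (\<exists>a\<in>H. \<exists>b\<in>H. parallel X a b \<and> edges_osculate X a b)"

definition hyperplanes_osculate :: "'q cube_complex \<Rightarrow> 'q set \<Rightarrow> 'q set \<Rightarrow> bool" where
  "hyperplanes_osculate X H H' \<longleftrightarrow> (\<exists>a\<in>H. \<exists>b\<in>H'. edges_osculate X a b)"

definition special :: "'q cube_complex \<Rightarrow> bool" where
  "special X \<longleftrightarrow>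
     cube_complex X \<and> nonpositively_curved X \<and>
     (\<forall>H\<in>hyperplanes X.
        \<not> hyperplanes_cross X H H \<and> two_sided X H \<and> \<not> directly_self_osculates X H) \<and>
     (\<forall>H\<in>hyperplanes X. \<forall>H'\<in>hyperplanes X.
        H \<noteq> H' \<longrightarrow> \<not> (hyperplanes_cross X H H' \<and> hyperplanes_osculate X H H'))"


section \<open>The fundamental group\<close>

fun edge_path :: "'q cube_complex \<Rightarrow> 'q \<Rightarrow> 'q list \<Rightarrow> 'q \<Rightarrow> bool" where
  "edge_path X u [] v \<longleftrightarrow> u \<in> vertices X \<and> u = v"
| "edge_path X u (a # p) v \<longleftrightarrow> a \<in> oriented_edges X \<and> src X a = u \<and> edge_path X (tgt X a) p v"

definition connected_complex :: "'q cube_complex \<Rightarrow> bool" where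
  "connected_complex X \<longleftrightarrow>
     vertices X \<noteq> {} \<and> (\<forall>u\<in>vertices X. \<forall>v\<in>vertices X. \<exists>p. edge_path X u p v)"

text \<open>
  Combinatorial homotopy relative to the end points: edge paths are changed by inserting or deleting
  backtracks and by pushing across squares.
\<close>

inductive homotopic_edge_paths :: "'q cube_complex \<Rightarrow> 'q \<Rightarrow> 'q \<Rightarrow> 'q list \<Rightarrow> 'q list \<Rightarrow> bool"
  for X u v where
  refl: "edge_path X u p v \<Longrightarrow> homotopic_edge_paths X u v p p"
| backtrack: "edge_path X u (p @ [a, rev_edge X a] @ p') v \<Longrightarrow>
    homotopic_edge_paths X u v (p @ [a, rev_edge X a] @ p') (p @ p')"
| square: "edge_path X u (p @ [bottom_side X q, right_side X q] @ p') v \<Longrightarrow> q \<in> squares X \<Longrightarrow>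
    homotopic_edge_paths X u v
      (p @ [bottom_side X q, right_side X q] @ p') (p @ [left_side X q, top_side X q] @ p')"
| sym: "homotopic_edge_paths X u v p p' \<Longrightarrow> homotopic_edge_paths X u v p' p"
| trans: "homotopic_edge_paths X u v p p' \<Longrightarrow> homotopic_edge_paths X u v p' p'' \<Longrightarrow>
    homotopic_edge_paths X u v p p''"

definition homotopy_class :: "'q cube_complex \<Rightarrow> 'q \<Rightarrow> 'q list \<Rightarrow> 'q list set" where
  "homotopy_class X v p = {p'. homotopic_edge_paths X v v p p'}"

definition fundamental_group :: "'q cube_complex \<Rightarrow> 'q \<Rightarrow> 'q list set monoid" where
  "fundamental_group X v =
     \<lparr> carrier = homotopy_class X v ` {p. edge_path X v p v},
       mult = (\<lambda>A B. \<Union>p\<in>A. \<Union>p'\<in>B. homotopy_class X v (p @ p')),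
       one = homotopy_class X v [] \<rparr>"


section \<open>Virtually compact special groups\<close>

text \<open>
  A compact complex has finitely many cells, so there is no loss in taking its parametrised cubes to
  be natural numbers.
\<close>

definition compact_special_group :: "('g, 'm) monoid_scheme \<Rightarrow> bool" where
  "compact_special_group G \<longleftrightarrow>
     (\<exists>(X :: nat cube_complex) v. special X \<and> compact_complex X \<and> connected_complex X \<and>
        v \<in> vertices X \<and> G \<cong> fundamental_group X v)"

definition virtually_compact_special :: "('g, 'm) monoid_scheme \<Rightarrow> bool" where
  "virtually_compact_special G \<longleftrightarrow>
     (\<exists>H. subgroup H G \<and> finite (rcosets\<^bsub>G\<^esub> H) \<and> compact_special_group (G\<lparr>carrier := H\<rparr>))"


section \<open>Word length and conjugacy\<close>

definition word_length :: "('g, 'm) monoid_scheme \<Rightarrow> 'g set \<Rightarrow> 'g \<Rightarrow> nat" where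
  "word_length G S g =
     (LEAST n. \<exists>ws. length ws = n \<and> set ws \<subseteq> S \<union> m_inv G ` S \<and> foldr (mult G) ws \<one>\<^bsub>G\<^esub> = g)"

definition conjugate_in :: "('g, 'm) monoid_scheme \<Rightarrow> 'g \<Rightarrow> 'g \<Rightarrow> bool" where
  "conjugate_in G a b \<longleftrightarrow> (\<exists>h\<in>carrier G. h \<otimes>\<^bsub>G\<^esub> a \<otimes>\<^bsub>G\<^esub> inv\<^bsub>G\<^esub> h = b)"

end

theory Submission
  imports Defs "HOL-Library.Sublist" "HOL-Library.Multiset"
begin

hide_const (open) Sublist.parallel Multiset.mult

text \<open>
  Label the oriented edges of a compact special complex by their parallelism classes.  Specialness
  says that the labels define a partial action of a right-angled Artin group on the finitely many
  vertices, and that two edge paths with the same end points are homotopic iff their words are equal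
  in that group.  So let \<open>a\<close>, \<open>b\<close>, \<open>g\<close> be words of loops with \<open>a g = g b\<close>; one has to shorten \<open>g\<close>.
  After cyclic reduction of \<open>a\<close> and \<open>b\<close>, and after replacing \<open>g\<close> by \<open>a\<^sup>m g\<close>, the equation holds in
  the trace monoid, where nothing cancels.  Then \<open>g = s t\<close>, where the letters of \<open>s\<close> occur in \<open>a\<close> and
  those of \<open>t\<close> commute with \<open>a\<close>.  Loops inside \<open>t\<close> may be cut out.  If \<open>s\<close> is long then it begins
  with a high power of a factor \<open>c\<close> of \<open>a\<close> that commutes with \<open>a\<close>; among the powers of \<open>c\<close> two lead
  to the same vertex, and again a loop may be cut out.  Hence \<open>N = 1\<close> suffices for compact special
  groups, and in general \<open>N\<close> only has to move all elements into the subgroup of finite index.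
\<close>

section \<open>Words and traces\<close>

text \<open>The obstacle is that a short conjugator in the right-angled Artin group need not be
  readable along a loop at the base vertex, so it need not come from the given group. Every change
  of the conjugator is therefore made on a word that labels a path. Rewriting keeps its end points,
  and the shortening deletes only factors which the path traverses as loops; this is why the number
  of vertices enters the constants. Traces are compared through their projections to pairs of
  dependent letters. This turns one equation in a partially commutative monoid into a family of
  equations between ordinary words, where prefixes, periods and first occurrences are
  elementary.\<close>

locale raag_words =
  fixes iv :: "'l \<Rightarrow> 'l" and I :: "'l \<Rightarrow> 'l \<Rightarrow> bool"
  assumes iv_iv [simp]: "iv (iv x) = x"
    and I_sym: "I x y \<Longrightarrow> I y x"
    and I_irrefl [simp]: "\<not> I x x"
    and I_iv: "I x y \<Longrightarrow> I (iv x) y"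
begin

lemma I_iv_iff [simp]: "I (iv x) y \<longleftrightarrow> I x y"
  using I_iv iv_iv by metis

lemma I_iv_right [simp]: "I x (iv y) \<longleftrightarrow> I x y"
  using I_iv_iff I_sym by metis

definition proj :: "'l \<Rightarrow> 'l \<Rightarrow> 'l list \<Rightarrow> 'l list" where
  "proj x y w = filter (\<lambda>z. z = x \<or> z = y) w"

lemma proj_append [simp]: "proj x y (u @ w) = proj x y u @ proj x y w"
  by (simp add: proj_def)

lemma proj_Nil [simp]: "proj x y [] = []"
  by (simp add: proj_def)

lemma proj_Cons: "proj x y (z # w) = (if z = x \<or> z = y then z # proj x y w else proj x y w)"
  by (simp add: proj_def)

lemma set_proj: "set (proj x y w) = {z \<in> set w. z = x \<or> z = y}"
  by (simp add: proj_def)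

text \<open>Equality in the trace monoid (letters commute iff related by \<open>I\<close>), by way of the projections
  to pairs of dependent letters.\<close>

definition teq :: "'l list \<Rightarrow> 'l list \<Rightarrow> bool" where
  "teq w w' \<longleftrightarrow> (\<forall>x y. \<not> I x y \<longrightarrow> proj x y w = proj x y w')"

lemma teqD: "teq w w' \<Longrightarrow> \<not> I x y \<Longrightarrow> proj x y w = proj x y w'"
  by (simp add: teq_def)

lemma teq_refl [simp]: "teq w w"
  by (simp add: teq_def)

lemma teq_sym: "teq w w' \<Longrightarrow> teq w' w"
  by (simp add: teq_def)

lemma teq_trans [trans]: "teq w w' \<Longrightarrow> teq w' w'' \<Longrightarrow> teq w w''"
  by (simp add: teq_def)

lemma teq_append: "teq u u' \<Longrightarrow> teq w w' \<Longrightarrow> teq (u @ w) (u' @ w')"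
  by (simp add: teq_def)

lemma teq_Cons: "teq w w' \<Longrightarrow> teq (x # w) (x # w')"
  using teq_append[of "[x]" "[x]"] by simp

lemma teq_cancel_left: "teq (u @ w) (u @ w') \<longleftrightarrow> teq w w'"
  by (simp add: teq_def)

lemma teq_cancel_right: "teq (w @ u) (w' @ u) \<longleftrightarrow> teq w w'"
  by (simp add: teq_def)

lemma teq_Cons_cancel: "teq (x # w) (x # w') \<longleftrightarrow> teq w w'"
  using teq_cancel_left[of "[x]"] by simp

text \<open>A pair of dependent letters cannot meet both words, so one of the two projections is
  empty.\<close>

lemma teq_commute:
  assumes "\<And>x y. x \<in> set u \<Longrightarrow> y \<in> set w \<Longrightarrow> I x y"
  shows "teq (u @ w) (w @ u)"
  unfolding teq_def
proof (intro allI impI)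
  fix x y assume d: "\<not> I x y"
  have "proj x y u = [] \<or> proj x y w = []"
  proof (rule ccontr)
    assume "\<not> ?thesis"
    then obtain p q where "p \<in> set (proj x y u)" "q \<in> set (proj x y w)"
      by (metis list.set_intros(1) neq_Nil_conv)
    then have "p \<in> set u" "q \<in> set w" "p = x \<or> p = y" "q = x \<or> q = y"
      by (simp_all add: set_proj)
    then show False using assms[of p q] d I_sym by auto
  qed
  then show "proj x y (u @ w) = proj x y (w @ u)" by auto
qed

lemma teq_move: "(\<And>y. y \<in> set m \<Longrightarrow> I x y) \<Longrightarrow> teq (m @ x # r) (x # m @ r)"
  using teq_append[OF teq_commute[of m "[x]"] teq_refl[of r]] I_sym by auto

text \<open>Every letter is dependent on itself, so the projection to the pair \<open>x\<close>,
  \<open>x\<close> counts the occurrences of \<open>x\<close>.\<close>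

lemma teq_mset:
  assumes "teq w w'" shows "mset w = mset w'"
proof (rule multiset_eqI)
  fix x
  have "proj x x w = proj x x w'" using assms by (simp add: teqD)
  then have "mset (filter (\<lambda>z. z = x) w) = mset (filter (\<lambda>z. z = x) w')"
    unfolding proj_def by simp
  then have "filter_mset (\<lambda>z. z = x) (mset w) = filter_mset (\<lambda>z. z = x) (mset w')"
    by (simp only: mset_filter)
  from arg_cong[OF this, of "\<lambda>M. count M x"]
  show "count (mset w) x = count (mset w') x"
    by (simp only: count_filter_mset if_True simp_thms)
qed

lemma teq_length: "teq w w' \<Longrightarrow> length w = length w'"
  using teq_mset size_mset by metis

lemma teq_set: "teq w w' \<Longrightarrow> set w = set w'"
  using teq_mset set_mset_mset by metis

text \<open>The part before the first \<open>x\<close> contains no \<open>x\<close>; a dependent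
  letter \<open>y\<close> in it would stand first in the projection to \<open>x\<close>,
  \<open>y\<close>.\<close>

lemma first_letter:
  assumes "\<And>y. \<not> I x y \<Longrightarrow> \<exists>q. proj x y w = x # q"
  obtains m r where "w = m @ x # r" "\<And>y. y \<in> set m \<Longrightarrow> I x y"
proof -
  obtain q where "proj x x w = x # q" using assms[OF I_irrefl] by blast
  then have "x \<in> set (proj x x w)" by simp
  then have "x \<in> set w" by (simp add: set_proj)
  then obtain m r where w: "w = m @ x # r" and xm: "x \<notin> set m"
    using split_list_first by metis
  have ind: "I x y" if "y \<in> set m" for y
  proof (rule ccontr)
    assume "\<not> I x y"
    then obtain q where "proj x y (m @ x # r) = x # q"
      using assms w by blast
    moreover have "proj x y m \<noteq> []" using that by (auto simp: proj_def filter_empty_conv)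
    ultimately have "hd (proj x y m) = x"
      by (metis hd_append2 list.sel(1) proj_append)
    then have "x \<in> set (proj x y m)"
      using \<open>proj x y m \<noteq> []\<close> list.set_sel(1) by fastforce
    then show False using xm by (simp add: set_proj)
  qed
  then show thesis using that w by blast
qed

text \<open>This turns equality of projections back into commutations of letters and drives the
  inductions on traces.\<close>

lemma teq_ConsD:
  assumes "teq w (x # w')"
  obtains m r where "w = m @ x # r" "\<And>y. y \<in> set m \<Longrightarrow> I x y" "teq (m @ r) w'"
proof -
  have "\<exists>q. proj x y w = x # q" if "\<not> I x y" for y
    using teqD[OF assms that] by (simp add: proj_Cons)
  then obtain m r where w: "w = m @ x # r" and ind: "\<And>y. y \<in> set m \<Longrightarrow> I x y"
    using first_letter[of x w] by blast
  have "teq (x # m @ r) (x # w')"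
    using teq_move[OF ind] assms w teq_sym teq_trans by blast
  then have "teq (m @ r) w'" by (simp add: teq_Cons_cancel)
  then show thesis using that w ind by blast
qed

lemma teq_Cons_split:
  "teq w (x # w') \<Longrightarrow> \<exists>m r. w = m @ x # r \<and> (\<forall>y\<in>set m. I x y) \<and> teq (m @ r) w'"
  using teq_ConsD by metis

lemma teq_Nil: "teq w [] \<Longrightarrow> w = []"
  using teq_length by fastforce

text \<open>Cancellation is directed on purpose. A path survives the deletion of an inverse pair
  from its word, but not the insertion of one, since the inserted letter need not label an edge at
  the vertex reached.\<close>

inductive step :: "'l list \<Rightarrow> 'l list \<Rightarrow> bool" where
  swap: "I x y \<Longrightarrow> step (u @ [x, y] @ w) (u @ [y, x] @ w)"
| cancel: "step (u @ [x, iv x] @ w) (u @ w)"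

abbreviation red :: "'l list \<Rightarrow> 'l list \<Rightarrow> bool" where
  "red \<equiv> step\<^sup>*\<^sup>*"

lemma step_context: "step w w' \<Longrightarrow> step (u @ w @ v) (u @ w' @ v)"
proof (induction rule: step.induct)
  case (swap x y p q)
  then show ?case using step.swap[of x y "u @ p" "q @ v"] by simp
next
  case (cancel p x q)
  then show ?case using step.cancel[of "u @ p" x "q @ v"] by simp
qed

lemma red_context: "red w w' \<Longrightarrow> red (u @ w @ v) (u @ w' @ v)"
  by (induction rule: rtranclp_induct) (auto intro: rtranclp.rtrancl_into_rtrancl step_context)

lemma red_Cons: "red w w' \<Longrightarrow> red (x # w) (x # w')"
  using red_context[of w w' "[x]" "[]"] by simp

lemma red_move: "(\<And>y. y \<in> set m \<Longrightarrow> I x y) \<Longrightarrow> red (m @ x # r) (x # m @ r)"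
proof (induction m)
  case (Cons y m)
  have "red (y # m @ x # r) (y # x # m @ r)"
    using Cons by (intro red_Cons) auto
  also have "step (y # x # m @ r) (x # y # m @ r)"
    using swap[of y x "[]"] Cons.prems I_sym by simp
  finally show ?case by simp
qed simp

lemma teq_imp_red: "teq w w' \<Longrightarrow> red w w'"
proof (induction w' arbitrary: w)
  case Nil
  then show ?case using teq_Nil by auto
next
  case (Cons x w')
  obtain m r where w: "w = m @ x # r" "\<And>y. y \<in> set m \<Longrightarrow> I x y" "teq (m @ r) w'"
    using teq_ConsD[OF Cons.prems] by blast
  have "red w (x # m @ r)" using red_move w by simp
  also have "red (x # m @ r) (x # w')" using Cons.IH w(3) by (simp add: red_Cons)
  finally show ?case .
qed


section \<open>Reduced words\<close>

definition reduced :: "'l list \<Rightarrow> bool" where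
  "reduced w \<longleftrightarrow> \<not> (\<exists>u x v. teq w (u @ [x, iv x] @ v))"

lemma reduced_teq: "teq w w' \<Longrightarrow> reduced w \<Longrightarrow> reduced w'"
  unfolding reduced_def using teq_trans by blast

lemma reduced_Nil [simp]: "reduced []"
  unfolding reduced_def using teq_sym teq_Nil by blast

lemma reduced_infix:
  assumes "reduced (u @ w @ v)" shows "reduced w"
  unfolding reduced_def
proof
  assume "\<exists>u x v. teq w (u @ [x, iv x] @ v)"
  then obtain u' x v' where "teq w (u' @ [x, iv x] @ v')" by blast
  then have "teq (u @ w @ v) ((u @ u') @ [x, iv x] @ (v' @ v))"
    using teq_append[OF teq_refl[of u] teq_append[OF _ teq_refl[of v]]] by fastforce
  then show False using assms unfolding reduced_def by blast
qed

lemma reduced_prefix: "reduced (u @ w) \<Longrightarrow> reduced u"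
  using reduced_infix[of "[]" u w] by simp

lemma reduced_suffix: "reduced (u @ w) \<Longrightarrow> reduced w"
  using reduced_infix[of u w "[]"] by simp

lemma reduced_Cons:
  "reduced (x # w) \<longleftrightarrow> reduced w \<and> \<not> (\<exists>u. teq w (iv x # u))"
proof (intro iffI conjI notI)
  show "reduced (x # w) \<Longrightarrow> reduced w" using reduced_suffix[of "[x]"] by simp
next
  assume r: "reduced (x # w)" and "\<exists>u. teq w (iv x # u)"
  then obtain u where "teq (x # w) ([] @ [x, iv x] @ u)" using teq_Cons by auto
  then show False using r unfolding reduced_def by blast
next
  assume a: "reduced w \<and> \<not> (\<exists>u. teq w (iv x # u))"
  show "reduced (x # w)"
    unfolding reduced_def
  proof
    assume "\<exists>u y v. teq (x # w) (u @ [y, iv y] @ v)"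
    then obtain u y v where t: "teq (u @ [y, iv y] @ v) (x # w)" using teq_sym by blast
    then obtain m r where s: "u @ [y, iv y] @ v = m @ x # r"
      "\<And>z. z \<in> set m \<Longrightarrow> I x z" "teq (m @ r) w"
      using teq_Cons_split by blast
    have no: False if "m @ r = p @ [z, iv z] @ q" for p z q
      using a that s(3) teq_sym unfolding reduced_def by metis
    \<comment> \<open>The leading \<open>x\<close> of the trace stands before the inverse pair, is
      its first letter, is its second letter, or stands after it.\<close>
    consider us where "u = m @ x # us"
      | "u = m" "x = y" "r = iv y # v"
      | "m = u @ [y]" "x = iv y"
      | us where "m = u @ [y, iv y] @ us" "v = us @ x # r"
      using s(1) by (auto simp: append_eq_append_conv2 append_eq_Cons_conv Cons_eq_append_conv)
    then show False
    proof cases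
      case 1
      then have "r = us @ [y, iv y] @ v" using s(1) by simp
      then show False using no[of "m @ us" y v] by simp
    next
      case 2
      then have "teq (iv x # m @ v) w"
        using s(3) teq_move[of m "iv x" v] s(2) teq_sym teq_trans by (metis I_iv_iff)
      then show False using a teq_sym by blast
    next
      case 3
      then show False using s(2)[of y] by simp
    next
      case 4
      then show False using no[of u y "us @ r"] by simp
    qed
  qed
qed

text \<open>Put the letters of \<open>u\<close> in front of \<open>v\<close> from right to left. The
  first one that destroys reducedness cancels against an inverse in \<open>v\<close>, and it
  commutes with everything in between, hence with the rest of \<open>u\<close>.\<close>

lemma reduced_append_cases:
  assumes "reduced u" "reduced v" "\<not> reduced (u @ v)"
  obtains x u' v' where "teq u (u' @ [x])" "teq v (iv x # v')"
  using assms
proof (induction u arbitrary: thesis)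
  case Nil
  then show ?case by simp
next
  case (Cons z u)
  show ?case
  proof (cases "reduced (u @ v)")
    case False
    moreover have "reduced u" using Cons.prems reduced_Cons by blast
    ultimately obtain x u' v' where "teq u (u' @ [x])" "teq v (iv x # v')"
      using Cons.IH Cons.prems by metis
    then show ?thesis using Cons.prems(1)[of "z # u'"] teq_Cons[of u "u' @ [x]" z] by simp
  next
    case True
    moreover have "\<not> reduced (z # (u @ v))" using Cons.prems(4) by simp
    ultimately obtain q where "teq (u @ v) (iv z # q)" unfolding reduced_Cons by blast
    then obtain m r where m: "u @ v = m @ iv z # r" "\<And>y. y \<in> set m \<Longrightarrow> I (iv z) y"
      using teq_Cons_split by blast
    consider us where "u = m @ iv z # us" | m' where "m = u @ m'" "v = m' @ iv z # r"
      using m(1) by (auto simp: append_eq_append_conv2 append_eq_Cons_conv Cons_eq_append_conv)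
    then show ?thesis
    proof cases
      case 1
      then have "teq u (iv z # m @ us)" using teq_move m(2) by simp
      then show ?thesis using Cons.prems(2) reduced_Cons by blast
    next
      case 2
      have "teq (z # u) (u @ [z])" using teq_move[of u z "[]"] m(2) 2 teq_sym by auto
      moreover have "teq v (iv z # m' @ r)" using teq_move[of m' "iv z" r] m(2) 2 by auto
      ultimately show ?thesis using Cons.prems(1) by blast
    qed
  qed
qed

text \<open>Left multiplication by a letter on reduced words, as in van der Waerden's proof of the
  normal form theorem for free products.\<close>

definition push :: "'l \<Rightarrow> 'l list \<Rightarrow> 'l list" where
  "push x w = (if \<exists>u. teq w (iv x # u) then SOME u. teq w (iv x # u) else x # w)"

lemma push_cases:
  obtains "teq w (iv x # push x w)" | "\<not> (\<exists>u. teq w (iv x # u))" "push x w = x # w"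
proof (cases "\<exists>u. teq w (iv x # u)")
  case True
  then have "teq w (iv x # (SOME u. teq w (iv x # u)))" by (rule someI_ex)
  then show thesis using that(1) True by (simp only: push_def if_True)
next
  case False
  then show thesis using that(2) by (simp only: push_def if_False simp_thms)
qed

lemma push_cancel: "teq w (iv x # u) \<Longrightarrow> teq (push x w) u"
proof (cases rule: push_cases[of w x])
  case 1
  assume "teq w (iv x # u)"
  then have "teq (iv x # push x w) (iv x # u)" using teq_trans[OF teq_sym[OF 1]] by blast
  then show ?thesis by (simp add: teq_Cons_cancel)
qed blast

lemma push_teq: "teq w w' \<Longrightarrow> teq (push x w) (push x w')"
proof (cases rule: push_cases[of w' x])
  case 1
  assume "teq w w'"
  then show ?thesis using push_cancel[OF teq_trans[OF _ 1]] by blast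
next
  case 2
  assume t: "teq w w'"
  then have "\<not> (\<exists>u. teq w (iv x # u))" using 2(1) teq_trans[OF teq_sym[OF t]] by blast
  then have "push x w = x # w" by (simp add: push_def)
  then show ?thesis using 2(2) teq_Cons[OF t] by simp
qed

lemma push_reduced: "reduced w \<Longrightarrow> reduced (push x w)"
proof (cases rule: push_cases[of w x])
  case 1
  assume "reduced w"
  then have "reduced (iv x # push x w)" using 1 reduced_teq by blast
  then show ?thesis unfolding reduced_Cons by blast
next
  case 2
  assume "reduced w"
  then show ?thesis using 2 reduced_Cons by simp
qed

lemma push_red: "red (x # w) (push x w)"
proof (cases rule: push_cases[of w x])
  case 1
  have "red (x # w) (x # iv x # push x w)" using 1 teq_imp_red red_Cons by blast
  also have "step (x # iv x # push x w) (push x w)"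
    using cancel[of "[]" x] by simp
  finally show ?thesis .
qed simp

text \<open>If \<open>iv x\<close> cancels a leading \<open>x\<close> of \<open>w\<close>,
  reducedness of \<open>w\<close> keeps the remainder from starting with \<open>iv x\<close>, so
  pushing \<open>x\<close> restores the letter.\<close>

lemma push_inverse:
  assumes "reduced w" shows "teq (push x (push (iv x) w)) w"
proof (cases rule: push_cases[of w "iv x"])
  case 1
  then have "reduced (x # push (iv x) w)" using assms reduced_teq by fastforce
  then have "push x (push (iv x) w) = x # push (iv x) w"
    unfolding push_def[of x] reduced_Cons by auto
  then show ?thesis using 1 teq_sym by simp
next
  case 2
  then show ?thesis using push_cancel[of "iv x # w" x w] by simp
qed

lemma teq_two_heads:
  assumes "teq w (x # u)" "teq w (y # v)" "I x y"
  obtains r where "teq u (y # r)"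
proof -
  have "teq (y # v) (x # u)" using assms teq_sym teq_trans by blast
  then obtain m r where m: "y # v = m @ x # r" "\<And>z. z \<in> set m \<Longrightarrow> I x z" "teq (m @ r) u"
    using teq_Cons_split by blast
  then obtain m' where "m = y # m'" using assms(3) by (cases m) auto
  then show thesis using that m(3) teq_sym by fastforce
qed

text \<open>The cases are whether \<open>x\<close> and \<open>y\<close> cancel in \<open>w\<close>.
  Commuting letters neither create nor destroy each other's cancellation, which is the content of
  fact \<open>A\<close>.\<close>

lemma push_commute:
  assumes "I x y" shows "teq (push x (push y w)) (push y (push x w))"
proof -
  have Iy: "I y x" using assms I_sym by blast
  have sw: "teq (a # b # w) (b # a # w)" if "I a b" for a b w
    using teq_move[of "[a]" b w] that I_sym by auto
  have A: "teq (push x (y # w)) (y # push x w)" if "I x y" for x y w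
  proof (cases rule: push_cases[of w x])
    case 1
    then have "teq (y # w) (iv x # y # push x w)"
      using sw[of y "iv x"] that I_sym teq_trans teq_Cons by (metis I_iv_iff)
    then show ?thesis by (rule push_cancel)
  next
    case 2
    show ?thesis
    proof (cases rule: push_cases[of "y # w" x])
      case 1
      then obtain m r where m: "y # w = m @ iv x # r" "\<And>z. z \<in> set m \<Longrightarrow> I (iv x) z"
        using teq_Cons_split by blast
      moreover have "m \<noteq> []"
        using m(1) I_iv[OF I_sym[OF that]] that by auto
      ultimately obtain m' where "w = m' @ iv x # r" "\<And>z. z \<in> set m' \<Longrightarrow> I (iv x) z"
        by (cases m) auto
      then have "teq w (iv x # m' @ r)" using teq_move by simp
      then show ?thesis using 2 by blast
    next
      case b: 2
      then show ?thesis using 2 sw[OF that] by simp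
    qed
  qed
  show ?thesis
  proof (cases rule: push_cases[of w x])
    case x: 1
    show ?thesis
    proof (cases rule: push_cases[of w y])
      case y: 1
      obtain r where r: "teq (push x w) (iv y # r)"
        using teq_two_heads[OF x y] assms by auto
      have "teq w (iv y # iv x # r)"
        using x r sw[of "iv x" "iv y"] assms teq_trans teq_Cons by (metis I_iv_iff I_iv_right)
      then have "teq (push y w) (iv x # r)" by (rule push_cancel)
      then have "teq (push x (push y w)) r" by (rule push_cancel)
      moreover have "teq (push y (push x w)) r" using r by (rule push_cancel)
      ultimately show ?thesis using teq_sym teq_trans by blast
    next
      case y: 2
      have "teq (push x (push y w)) (y # push x w)" using y A[OF assms] by simp
      moreover have "\<not> (\<exists>u. teq (push x w) (iv y # u))"
      proof
        assume "\<exists>u. teq (push x w) (iv y # u)"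
        then obtain u where "teq w (iv x # iv y # u)" using x teq_trans teq_Cons by blast
        then have "teq w (iv y # iv x # u)"
          using sw[of "iv x" "iv y"] assms teq_trans by (metis I_iv_iff I_iv_right)
        then show False using y by blast
      qed
      then have "push y (push x w) = y # push x w" by (simp add: push_def[of y])
      ultimately show ?thesis by simp
    qed
  next
    case x: 2
    have "teq (push y (push x w)) (x # push y w)" using x A[OF Iy] by simp
    moreover have "teq (push x (push y w)) (x # push y w)"
    proof (cases rule: push_cases[of w y])
      case y: 1
      have "\<not> (\<exists>u. teq (push y w) (iv x # u))"
      proof
        assume "\<exists>u. teq (push y w) (iv x # u)"
        then obtain u where "teq w (iv y # iv x # u)" using y teq_trans teq_Cons by blast
        then have "teq w (iv x # iv y # u)"
          using sw[of "iv y" "iv x"] Iy teq_trans by (metis I_iv_iff I_iv_right)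
        then show False using x by blast
      qed
      then show ?thesis by (simp add: push_def[of x])
    next
      case y: 2
      then show ?thesis using A[OF assms, of w] sw[OF Iy, of w] x teq_trans by simp
    qed
    ultimately show ?thesis using teq_sym teq_trans by blast
  qed
qed

lemma foldr_push_teq: "teq z z' \<Longrightarrow> teq (foldr push w z) (foldr push w z')"
  by (induction w) (auto intro: push_teq)

lemma foldr_push_reduced: "reduced z \<Longrightarrow> reduced (foldr push w z)"
  by (induction w) (auto intro: push_reduced)

text \<open>The relations hold for the action by \<open>push\<close>: \<open>push_commute\<close>
  treats swaps and \<open>push_inverse\<close> treats cancellations. Applied to the empty word, this
  yields uniqueness of normal forms up to \<open>teq\<close>.\<close>

lemma foldr_push_red:
  assumes "red w w'" "reduced z"
  shows "teq (foldr push w z) (foldr push w' z)"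
  using assms(1)
proof (induction rule: rtranclp_induct)
  case (step w' w'')
  have "teq (foldr push w' z) (foldr push w'' z)"
    using step.hyps(2)
  proof cases
    case (swap x y u w)
    then show ?thesis using foldr_push_teq[OF push_commute] by simp
  next
    case (cancel u x w)
    then show ?thesis
      using foldr_push_teq[OF push_inverse[OF foldr_push_reduced[OF assms(2)]]] by simp
  qed
  then show ?case using step.IH teq_trans by blast
qed simp

definition nf :: "'l list \<Rightarrow> 'l list" where
  "nf w = foldr push w []"

lemma nf_simps [simp]: "nf [] = []" "nf (x # w) = push x (nf w)"
  by (simp_all add: nf_def)

lemma nf_reduced [simp]: "reduced (nf w)"
  by (simp add: nf_def foldr_push_reduced)

lemma red_nf: "red w (nf w)"
proof (induction w)
  case (Cons x w)
  then have "red (x # w) (push x (nf w))"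
    by (rule rtranclp_trans[OF red_Cons push_red])
  then show ?case by simp
qed simp

lemma nf_append: "nf (u @ w) = foldr push u (nf w)"
  by (simp add: nf_def)

lemma reduced_imp_nf: "reduced w \<Longrightarrow> teq (nf w) w"
proof (induction w)
  case (Cons x w)
  then have "teq (nf (x # w)) (push x w)" using reduced_Cons push_teq by simp
  also have "push x w = x # w" using Cons.prems reduced_Cons by (simp add: push_def)
  finally show ?case .
qed simp

lemma length_push: "length (push x w) \<le> Suc (length w)"
  by (cases rule: push_cases[of w x]) (auto dest: teq_length)

lemma length_foldr_push: "length (foldr push u w) \<le> length u + length w"
  by (induction u) (use length_push in \<open>auto intro: order_trans\<close>)

lemma length_nf: "length (nf w) \<le> length w"
  using length_foldr_push[of w "[]"] by (simp add: nf_def)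

text \<open>A push that cancels shortens the word, so full length means that no letter cancelled.
  This makes reducedness a matter of counting in \<open>trace_conjugator\<close>.\<close>

lemma length_nf_eq_imp_reduced: "length (nf w) = length w \<Longrightarrow> reduced w"
proof (induction w)
  case (Cons x w)
  have l: "length (nf w) \<le> length w" by (rule length_nf)
  have "length (push x (nf w)) = Suc (length w)" using Cons.prems by simp
  then have n: "\<not> teq (nf w) (iv x # push x (nf w))" "length (nf w) = length w"
    using length_push[of x "nf w"] l teq_length[of "nf w" "iv x # push x (nf w)"] by auto
  then have r: "reduced w" using Cons.IH by blast
  have "\<not> (\<exists>u. teq (nf w) (iv x # u))" using push_cases[of "nf w" x] n(1) by blast
  then show ?case using r reduced_Cons reduced_imp_nf teq_trans by blast
qed simp

text \<open>Equality in the right-angled Artin group.\<close>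

definition eqv :: "'l list \<Rightarrow> 'l list \<Rightarrow> bool" where
  "eqv w w' \<longleftrightarrow> teq (nf w) (nf w')"

lemma eqv_refl [simp]: "eqv w w"
  by (simp add: eqv_def)

lemma eqv_sym: "eqv w w' \<Longrightarrow> eqv w' w"
  by (simp add: eqv_def teq_sym)

lemma eqv_trans [trans]: "eqv w w' \<Longrightarrow> eqv w' w'' \<Longrightarrow> eqv w w''"
  unfolding eqv_def by (rule teq_trans)

lemma red_imp_eqv: "red w w' \<Longrightarrow> eqv w w'"
  unfolding eqv_def nf_def by (rule foldr_push_red) simp_all

lemma teq_imp_eqv: "teq w w' \<Longrightarrow> eqv w w'"
  using teq_imp_red red_imp_eqv by blast

lemma eqv_nf: "eqv w (nf w)"
  using red_nf red_imp_eqv by blast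

lemma eqv_append:
  assumes "eqv u u'" "eqv w w'" shows "eqv (u @ w) (u' @ w')"
proof -
  have A: "teq (nf (u @ w)) (foldr push (nf u) (nf w))" for u w
    unfolding nf_append by (rule foldr_push_red) (simp_all add: red_nf)
  have "teq (foldr push (nf u) (nf w)) (foldr push (nf u') (nf w))"
    using assms(1) unfolding eqv_def by (intro foldr_push_red teq_imp_red) simp_all
  also have "teq \<dots> (foldr push (nf u') (nf w'))"
    using assms(2) unfolding eqv_def by (rule foldr_push_teq)
  finally show ?thesis unfolding eqv_def using A teq_sym teq_trans by blast
qed

lemma eqv_reduced_imp_teq: "eqv w w' \<Longrightarrow> reduced w \<Longrightarrow> reduced w' \<Longrightarrow> teq w w'"
  unfolding eqv_def by (meson reduced_imp_nf teq_sym teq_trans)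

definition winv :: "'l list \<Rightarrow> 'l list" where
  "winv w = rev (map iv w)"

lemma winv_simps [simp]: "winv [] = []" "winv (x # w) = winv w @ [iv x]"
  "winv (u @ w) = winv w @ winv u" "winv (winv w) = w" "length (winv w) = length w"
  by (simp_all add: winv_def rev_map comp_def)

lemma eqv_winv_right: "eqv (w @ winv w) []"
proof (induction w)
  case (Cons x w)
  have "eqv ([x] @ (w @ winv w) @ [iv x]) ([x] @ [] @ [iv x])"
    using Cons by (intro eqv_append) simp_all
  also have "eqv \<dots> []" using red_imp_eqv[OF r_into_rtranclp[of step, OF cancel[of "[]" x "[]"]]] by simp
  finally show ?case by simp
qed simp

lemma eqv_winv_left: "eqv (winv w @ w) []"
  using eqv_winv_right[of "winv w"] by simp

end


text \<open>The defect \<open>f m + d - m * c\<close> is a natural number by \<open>low\<close> and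
  does not increase by \<open>up\<close>, so it is constant from a point on where it attains its
  minimum.\<close>

lemma eventually_additive:
  fixes f :: "nat \<Rightarrow> nat"
  assumes up: "\<And>m. f (Suc m) \<le> c + f m" and low: "\<And>m. m * c \<le> f m + d"
  obtains m0 where "\<And>m. m \<ge> m0 \<Longrightarrow> f (Suc m) = c + f m"
proof -
  define D where "D m = f m + d - m * c" for m
  have dec: "D (Suc m) \<le> D m" for m
    using up[of m] low[of m] low[of "Suc m"] unfolding D_def by simp
  obtain m0 where m0: "\<And>m. D m0 \<le> D m"
    using ex_has_least_nat[of "\<lambda>_. True" 0 D] by auto
  have "f (Suc m) = c + f m" if "m \<ge> m0" for m
  proof -
    have "D m \<le> D m0" using lift_Suc_antimono_le[of D, OF dec that] .
    then have "D (Suc m) = D m" using dec[of m] m0[of "Suc m"] by simp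
    then show ?thesis using low[of m] low[of "Suc m"] unfolding D_def by simp
  qed
  then show thesis using that by blast
qed

section \<open>Powers of ordinary words and their prefixes\<close>

abbreviation wpow :: "nat \<Rightarrow> 'a list \<Rightarrow> 'a list" where
  "wpow n w \<equiv> concat (replicate n w)"

lemma wpow_add: "wpow (m + n) w = wpow m w @ wpow n w"
  by (simp add: replicate_add)

lemma wpow_Suc_right: "wpow (Suc n) w = wpow n w @ w"
  using wpow_add[of n 1 w] by simp

lemma length_wpow: "length (wpow n w) = n * length w"
  by (induction n) simp_all

lemma count_list_wpow: "count_list (wpow n w) z = n * count_list w z"
  by (induction n) simp_all

lemma count_list_prefix: "prefix u w \<Longrightarrow> count_list u z \<le> count_list w z"
  by (auto simp: prefix_def)

text \<open>Both words are prefixes of one larger power of \<open>u\<close>, so they are comparable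
  and their lengths decide.\<close>

lemma prefix_wpow_cases:
  assumes "prefix s (wpow n u)"
  shows "if q * length u \<le> length s then prefix (wpow q u) s else prefix s (wpow q u)"
proof -
  have "prefix (wpow k u) (wpow (max n q) u)" if "k \<le> max n q" for k
    using wpow_add[of k "max n q - k" u] that by (metis le_add_diff_inverse prefixI)
  then have "prefix (wpow q u) (wpow (max n q) u)" "prefix s (wpow (max n q) u)"
    using assms prefix_order.trans by (blast intro: max.cobounded1 max.cobounded2)+
  then show ?thesis
    using prefix_length_prefix[of "wpow q u" _ s] prefix_length_prefix[of s _ "wpow q u"]
    by (simp add: length_wpow)
qed

context raag_words
begin

section \<open>Cyclically reduced words\<close>

text \<open>A cancellation between \<open>a\<close> and the following power uses a letter
  \<open>iv x\<close> that can be moved to the front of that power. If it lies in the first copy of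
  \<open>a\<close>, then \<open>a @ a\<close> cancels already; otherwise it commutes with all of
  \<open>a\<close>, hence with itself.\<close>

lemma reduced_wpow:
  assumes "reduced (a @ a)" shows "reduced (wpow n a)"
proof (induction n)
  case (Suc n)
  have a: "reduced a" using assms by (rule reduced_prefix)
  show ?case
  proof (rule ccontr)
    assume "\<not> reduced (wpow (Suc n) a)"
    then have "\<not> reduced (a @ wpow n a)" by simp
    then obtain x u v where x: "teq a (u @ [x])" "teq (wpow n a) (iv x # v)"
      using reduced_append_cases[OF a Suc.IH] by blast
    then obtain m r where m: "wpow n a = m @ iv x # r" "\<forall>y\<in>set m. I (iv x) y"
      using teq_Cons_split by blast
    then obtain k where k: "n = Suc k" by (cases n) auto
    have "iv x \<in> set (wpow n a)" using m(1) by simp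
    then have ain: "iv x \<in> set a" by auto
    have "a @ wpow k a = m @ iv x # r" using m(1) k by simp
    then consider us where "a = m @ iv x # us" | m' where "m = a @ m'"
      by (auto simp: append_eq_append_conv2 append_eq_Cons_conv Cons_eq_append_conv)
    then show False
    proof cases
      case 1
      then have "teq a (iv x # m @ us)" using teq_move m(2) by simp
      then have "teq (a @ a) ((u @ [x]) @ (iv x # m @ us))" using x(1) teq_append by blast
      then have "teq (a @ a) (u @ [x, iv x] @ (m @ us))" by simp
      then show False using assms unfolding reduced_def by blast
    next
      case 2
      then have "I (iv x) (iv x)" using ain m(2) by (metis Un_iff set_append)
      then show False by (simp only: I_irrefl)
    qed
  qed
qed simp

lemma not_cyclically_reduced:
  assumes "reduced a" "\<not> reduced (a @ a)" "\<And>x. x \<in> set a \<Longrightarrow> iv x \<noteq> x"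
  obtains x w where "teq a (iv x # w @ [x])"
proof -
  obtain x u v where x: "teq a (u @ [x])" "teq a (iv x # v)"
    using reduced_append_cases assms by metis
  then have "teq (u @ [x]) (iv x # v)" using teq_sym teq_trans by meson
  then obtain m r where m: "u @ [x] = m @ iv x # r" "\<forall>y\<in>set m. I (iv x) y"
    using teq_Cons_split by blast
  \<comment> \<open>This excludes that the \<open>iv x\<close> moved to the front and the final
    \<open>x\<close> are one and the same letter of the word.\<close>
  have "iv x \<noteq> x" using assms(3)[of x] teq_set[OF x(1)] by simp
  then obtain r' where r: "u = m @ iv x # r'"
    using m(1) by (cases r rule: rev_cases) auto
  then have "teq u (iv x # m @ r')" using teq_move m(2) by simp
  then have "teq (u @ [x]) (iv x # (m @ r') @ [x])"
    using teq_append[OF _ teq_refl, of u _ "[x]"] by fastforce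
  then show thesis using that x(1) teq_trans by blast
qed

lemma length_nf_eqv: "eqv w w' \<Longrightarrow> length (nf w) = length (nf w')"
  unfolding eqv_def by (rule teq_length)

lemma length_nf_append: "length (nf (u @ w)) \<le> length (nf u) + length (nf w)"
proof -
  have "eqv (u @ w) (nf u @ nf w)" by (intro eqv_append eqv_nf)
  then show ?thesis using length_nf_eqv length_nf[of "nf u @ nf w"] by simp
qed

lemma length_nf_reduced: "reduced w \<Longrightarrow> length (nf w) = length w"
  using reduced_imp_nf teq_length by blast

lemma eqv_context: "eqv w w' \<Longrightarrow> eqv (u @ w @ v) (u @ w' @ v)"
  by (intro eqv_append eqv_refl)

lemma eqv_wpow_conj: "eqv (a @ h) (h @ b) \<Longrightarrow> eqv (wpow n a @ h) (h @ wpow n b)"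
proof (induction n)
  case (Suc n)
  have "eqv (a @ (wpow n a @ h) @ []) (a @ (h @ wpow n b) @ [])"
    using Suc by (intro eqv_context) simp
  also have "eqv (a @ (h @ wpow n b) @ []) ((h @ b) @ wpow n b)"
    using eqv_append[OF Suc.prems eqv_refl, of "wpow n b"] by simp
  finally show ?case by simp
qed simp

text \<open>Replacing \<open>h\<close> by \<open>a\<^sup>m h\<close> for a large \<open>m\<close> makes all cancellation disappear, so that the
  conjugacy relation becomes an equation between traces.\<close>

lemma trace_conjugator:
  assumes a: "reduced (a @ a)" and b: "reduced (b @ b)" and h: "eqv (a @ h) (h @ b)"
  obtains m h' where "red (wpow m a @ h) h'" "teq (a @ h') (h' @ b)"
proof -
  have lp: "length (nf (wpow m w)) = m * length w" if "reduced (w @ w)" for m w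
    using reduced_wpow[OF that] by (simp add: length_nf_reduced length_wpow)
  obtain m1 where m1: "\<And>m. m \<ge> m1 \<Longrightarrow>
      length (nf (wpow (Suc m) a @ h)) = length a + length (nf (wpow m a @ h))"
  proof (rule eventually_additive)
    show "length (nf (wpow (Suc m) a @ h)) \<le> length a + length (nf (wpow m a @ h))" for m
      using length_nf_append[of a "wpow m a @ h"] length_nf[of a] by simp
    \<comment> \<open>Multiplying back by \<open>winv h\<close> recovers the power of
      \<open>a\<close>, whose normal form has full length; so \<open>h\<close> can absorb only a
      number of letters that does not depend on \<open>m\<close>.\<close>
    show "m * length a \<le> length (nf (wpow m a @ h)) + length (nf (winv h))" for m
    proof -
      have "eqv (wpow m a @ h @ winv h) (wpow m a @ [])"
        by (intro eqv_append eqv_winv_right) simp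
      from length_nf_eqv[OF this] show ?thesis
        using length_nf_append[of "wpow m a @ h" "winv h"] lp[OF a, of m] by simp
    qed
  qed blast
  obtain m2 where m2: "\<And>m. m \<ge> m2 \<Longrightarrow>
      length (nf (h @ wpow (Suc m) b)) = length b + length (nf (h @ wpow m b))"
  proof (rule eventually_additive)
    show "length (nf (h @ wpow (Suc m) b)) \<le> length b + length (nf (h @ wpow m b))" for m
      using length_nf_append[of "h @ wpow m b" b] length_nf[of b] unfolding wpow_Suc_right by simp
    show "m * length b \<le> length (nf (h @ wpow m b)) + length (nf (winv h))" for m
    proof -
      have "eqv ((winv h @ h) @ wpow m b) ([] @ wpow m b)"
        by (intro eqv_append eqv_winv_left) simp
      from length_nf_eqv[OF this] show ?thesis
        using length_nf_append[of "winv h" "h @ wpow m b"] lp[OF b, of m] by simp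
    qed
  qed blast
  \<comment> \<open>For this \<open>m\<close> the normal form \<open>h'\<close> of both
    \<open>wpow m a @ h\<close> and \<open>h @ wpow m b\<close> cancels neither against
    \<open>a\<close> on its left nor against \<open>b\<close> on its right.\<close>
  define m where "m = max m1 m2"
  define h' where "h' = nf (wpow m a @ h)"
  have e1: "eqv (wpow m a @ h) h'" unfolding h'_def by (rule eqv_nf)
  have e2: "eqv (h @ wpow m b) h'"
    using e1 eqv_wpow_conj[OF h] eqv_sym eqv_trans by blast
  have e3: "eqv (wpow (Suc m) a @ h) (a @ h')"
    using eqv_context[OF e1, of a "[]"] by simp
  have e4: "eqv (h @ wpow (Suc m) b) (h' @ b)"
    using eqv_context[OF e2, of "[]" b] unfolding wpow_Suc_right by simp
  have "length (nf (a @ h')) = length (a @ h')"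
    using m1[of m] length_nf_eqv[OF e3] by (simp add: m_def h'_def)
  then have r1: "reduced (a @ h')" by (rule length_nf_eq_imp_reduced)
  have "length (nf (h @ wpow m b)) = length h'"
    using length_nf_eqv[OF e2] by (simp add: h'_def length_nf_reduced)
  then have "length (nf (h' @ b)) = length (h' @ b)"
    using m2[of m] length_nf_eqv[OF e4] by (simp add: m_def)
  then have r2: "reduced (h' @ b)" by (rule length_nf_eq_imp_reduced)
  have "eqv (a @ h') (h' @ b)"
    using e3 e4 eqv_wpow_conj[OF h, of "Suc m"] eqv_sym eqv_trans by blast
  then have "teq (a @ h') (h' @ b)" using r1 r2 by (rule eqv_reduced_imp_teq)
  moreover have "red (wpow m a @ h) h'" unfolding h'_def by (rule red_nf)
  ultimately show thesis using that by blast
qed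


section \<open>Conjugation of traces\<close>

lemma proj_wpow: "proj x y (wpow n w) = wpow n (proj x y w)"
  by (induction n) simp_all

lemma count_list_proj: "z = x \<or> z = y \<Longrightarrow> count_list (proj x y w) z = count_list w z"
  by (induction w) (auto simp: proj_Cons)

text \<open>Left divisibility of traces can be tested on projections: the prefix hypotheses put the
  next letter of \<open>s\<close> first in all relevant projections, so it can be moved to the front
  of \<open>w\<close>.\<close>

lemma trace_prefix:
  assumes "\<And>x y. \<not> I x y \<Longrightarrow> prefix (proj x y s) (proj x y w)"
  shows "\<exists>r. teq w (s @ r)"
  using assms
proof (induction s arbitrary: w)
  case Nil
  show ?case by (rule exI[of _ w]) simp
next
  case (Cons x s)
  have "\<exists>q. proj x y w = x # q" if "\<not> I x y" for y
    using Cons.prems[OF that] by (auto simp: proj_Cons prefix_def)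
  then obtain m r where w: "w = m @ x # r" "\<And>y. y \<in> set m \<Longrightarrow> I x y"
    using first_letter[of x w] by blast
  have t: "teq w (x # m @ r)" using w teq_move by simp
  have "prefix (proj y z s) (proj y z (m @ r))" if "\<not> I y z" for y z
    using Cons.prems[OF that] teqD[OF t that] by (auto simp: proj_Cons split: if_splits)
  then obtain q where "teq (m @ r) (s @ q)" using Cons.IH by blast
  then have "teq (x # m @ r) ((x # s) @ q)" using teq_Cons by simp
  then show ?case using t teq_trans by blast
qed

lemma teq_wpow_conj: "teq (a @ s) (s @ b) \<Longrightarrow> teq (wpow n a @ s) (s @ wpow n b)"
proof (induction n)
  case (Suc n)
  have "teq (a @ (wpow n a @ s)) (a @ (s @ wpow n b))"
    using Suc by (intro teq_append[OF teq_refl])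
  also have "teq (a @ (s @ wpow n b)) ((s @ b) @ wpow n b)"
    using teq_append[OF Suc.prems teq_refl[of "wpow n b"]] by simp
  finally show ?case by simp
qed simp

lemma teq_partition:
  assumes "\<And>x y. x \<in> set h \<Longrightarrow> y \<in> set h \<Longrightarrow> P x \<Longrightarrow> \<not> P y \<Longrightarrow> I x y"
  shows "teq h (filter P h @ filter (\<lambda>x. \<not> P x) h)"
  using assms
proof (induction h)
  case (Cons x h)
  have IH: "teq (x # h) (x # filter P h @ filter (\<lambda>x. \<not> P x) h)"
    using Cons by (intro teq_Cons) simp
  show ?case
  proof (cases "P x")
    case True
    then show ?thesis using IH by simp
  next
    case False
    then have "teq (filter P h @ x # filter (\<lambda>x. \<not> P x) h) (x # filter P h @ filter (\<lambda>x. \<not> P x) h)"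
      using Cons.prems I_sym by (intro teq_move) auto
    from teq_trans[OF IH teq_sym[OF this]] show ?thesis using False by simp
  qed
qed simp

text \<open>If \<open>x\<close> and \<open>y\<close> were dependent, compare what precedes the first
  \<open>x\<close> in the projections of the two sides. On the left it is longer by the projection
  of \<open>a\<close>, which contains \<open>y\<close>.\<close>

lemma conjugator_indep:
  assumes "teq (a @ h) (h @ b)" "y \<in> set a" "x \<in> set h" "x \<notin> set a"
  shows "I x y"
proof (rule ccontr)
  assume "\<not> I x y"
  let ?T = "takeWhile (\<lambda>z. z \<noteq> x)" and ?p = "proj x y"
  have "?p a @ ?p h = ?p h @ ?p b" using teqD[OF assms(1) \<open>\<not> I x y\<close>] by simp
  moreover have "?T (?p a @ ?p h) = ?p a @ ?T (?p h)"
    using assms(4) by (intro takeWhile_append2) (auto simp: set_proj)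
  moreover have "?T (?p h @ ?p b) = ?T (?p h)"
    using assms(3) by (intro takeWhile_append1[of x]) (auto simp: set_proj)
  ultimately have "?p a = []" by simp
  moreover have "y \<in> set (?p a)" using assms(2) by (simp add: set_proj)
  ultimately show False by simp
qed

text \<open>Letters of \<open>h\<close> outside \<open>a\<close> commute with all letters of
  \<open>a\<close>, so they can be collected at the end. The words \<open>a\<close> and
  \<open>b\<close> have the same letters by counting, so the collected part also moves past
  \<open>b\<close> and cancels from the equation.\<close>

lemma split_conjugator:
  assumes "teq (a @ h) (h @ b)"
  obtains s t where "teq h (s @ t)" "teq (a @ s) (s @ b)" "set s \<subseteq> set a"
    "\<And>x y. x \<in> set t \<Longrightarrow> y \<in> set b \<Longrightarrow> I x y"
proof -
  define s t where "s = filter (\<lambda>x. x \<in> set a) h" and "t = filter (\<lambda>x. x \<notin> set a) h"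
  have "set b = set a"
    using teq_mset[OF assms] by (intro mset_eq_setD) simp
  then have ind: "I x y" if "x \<in> set t" "y \<in> set b" for x y
    using that conjugator_indep[OF assms, of y x] by (simp add: t_def)
  have h: "teq h (s @ t)"
    unfolding s_def t_def using conjugator_indep[OF assms] I_sym by (intro teq_partition) blast
  have "teq ((a @ s) @ t) (a @ h)" using teq_append[OF teq_refl teq_sym[OF h], of a] by simp
  also have "teq (a @ h) (h @ b)" by (rule assms)
  also have "teq (h @ b) (s @ (t @ b))" using teq_append[OF h teq_refl, of b] by simp
  also have "teq (s @ (t @ b)) (s @ (b @ t))"
    using ind by (intro teq_append teq_commute teq_refl)
  finally have "teq ((a @ s) @ t) ((s @ b) @ t)" by simp
  then have "teq (a @ s) (s @ b)" by (simp only: teq_cancel_right)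
  moreover have "set s \<subseteq> set a" by (auto simp: s_def)
  ultimately show thesis using that h ind by blast
qed

text \<open>A long solution \<open>s\<close> of \<open>a s = s b\<close> is a prefix of a power of \<open>a\<close>.  The numbers \<open>f z\<close> of
  periods of \<open>a\<close> that \<open>s\<close> contains, counted in the letter \<open>z\<close>, differ by at most one for dependent
  letters.  Hence a gap \<open>j\<close> in the values of \<open>f\<close> splits \<open>a\<close> into two commuting factors, one of
  which has a large power that is a prefix of \<open>s\<close>.\<close>

lemma periodic_prefix:
  assumes ab: "teq (a @ s) (s @ b)" and sa: "set s \<subseteq> set a"
    and L: "finite L" "set a \<subseteq> L" and long: "length s > (P + card L + 2) * length a"
  obtains c r where "c \<noteq> []" "set c \<subseteq> set a" "teq (a @ c) (c @ a)" "teq s (wpow P c @ r)"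
proof -
  \<comment> \<open>Iterating the relation makes \<open>s\<close> a left divisor of
    \<open>wpow n a @ s\<close>. With \<open>n = length s\<close> the power alone is long enough in
    every projection in which \<open>a\<close> is visible.\<close>
  have pre: "prefix (proj x y s) (wpow (length s) (proj x y a))" if "\<not> I x y" for x y
  proof (cases "proj x y a = []")
    case True
    then have "x \<notin> set a" "y \<notin> set a" by (auto simp: proj_def filter_empty_conv)
    then have "proj x y s = []" using sa by (auto simp: proj_def filter_empty_conv)
    then show ?thesis by simp
  next
    case False
    let ?n = "length s"
    have "prefix (proj x y s) (wpow ?n (proj x y a) @ proj x y s)"
      using teqD[OF teq_wpow_conj[OF ab, of ?n] that] by (simp add: proj_wpow)
    moreover have "length (proj x y s) \<le> length (wpow ?n (proj x y a))"
    proof -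
      have "length (proj x y s) \<le> ?n" by (simp add: proj_def)
      also have "?n \<le> ?n * length (proj x y a)" using False by (cases "proj x y a") auto
      finally show ?thesis by (simp add: length_wpow)
    qed
    ultimately show ?thesis using prefix_length_prefix prefixI by blast
  qed
  define f where "f z = count_list s z div count_list a z" for z
  have pos: "count_list a z > 0" if "z \<in> set a" for z
    using that by (metis count_list_0_iff gr0I)
  have f_ge: "q \<le> f z \<longleftrightarrow> q * count_list a z \<le> count_list s z" if "z \<in> set a" for z q
    using pos[OF that] by (simp add: f_def less_eq_div_iff_mult_less_eq)
  have full: "q \<le> f z'"
    if "\<not> I x y" "q * length (proj x y a) \<le> length (proj x y s)" "z' \<in> set a" "z' = x \<or> z' = y"
    for x y z' q
  proof -
    have "prefix (wpow q (proj x y a)) (proj x y s)"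
      using prefix_wpow_cases[OF pre[OF that(1)], of q] that(2) by simp
    from count_list_prefix[OF this, of z'] show ?thesis
      using f_ge that(3,4) by (simp add: count_list_wpow count_list_proj)
  qed
  have short: "f z \<le> q"
    if "\<not> I x y" "\<not> q * length (proj x y a) \<le> length (proj x y s)" "z \<in> set a" "z = x \<or> z = y"
    for x y z q
  proof -
    have "prefix (proj x y s) (wpow q (proj x y a))"
      using prefix_wpow_cases[OF pre[OF that(1)], of q] that(2) by simp
    from count_list_prefix[OF this, of z]
    have "count_list s z \<le> q * count_list a z"
      using that(4) by (simp add: count_list_wpow count_list_proj)
    then show ?thesis using pos[OF that(3)] unfolding f_def
      by (metis div_le_mono nonzero_mult_div_cancel_right not_gr_zero)
  qed
  obtain x0 where x0: "x0 \<in> set a" "f x0 \<ge> P + card L + 2"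
  proof (atomize_elim, rule ccontr)
    assume no: "\<not> (\<exists>x0. x0 \<in> set a \<and> P + card L + 2 \<le> f x0)"
    have "count_list s z \<le> (P + card L + 2) * count_list a z" if "z \<in> set a" for z
      using no that f_ge[OF that, of "P + card L + 2"] nat_le_linear by blast
    then have "(\<Sum>z\<in>set a. count_list s z) \<le> (\<Sum>z\<in>set a. (P + card L + 2) * count_list a z)"
      by (rule sum_mono)
    also have "\<dots> = (P + card L + 2) * (\<Sum>z\<in>set a. count_list a z)"
      by (rule sum_distrib_left[symmetric])
    finally have "length s \<le> (P + card L + 2) * length a"
      by (simp only: sum_count_set[OF sa finite_set] sum_count_set[OF subset_refl finite_set])
    then show False using long by simp
  qed
  \<comment> \<open>There are \<open>card L + 1\<close> candidates and at most \<open>card L\<close>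
    values of \<open>f\<close>. A gap above \<open>P\<close> leaves room for \<open>P\<close>
    periods of \<open>c\<close>; a gap below \<open>P + card L + 2\<close> puts \<open>x0\<close>
    into \<open>c\<close>, so that \<open>c\<close> is not empty.\<close>
  have "\<exists>j\<in>{P+1..P+1+card L}. j \<notin> f ` set a"
  proof (rule ccontr)
    assume "\<not> ?thesis"
    then have "{P+1..P+1+card L} \<subseteq> f ` set a" by auto
    then have "card {P+1..P+1+card L} \<le> card (f ` set a)" by (intro card_mono) auto
    also have "\<dots> \<le> card (set a)" by (rule card_image_le) simp
    also have "\<dots> \<le> card L" using L by (rule card_mono)
    finally show False by simp
  qed
  then obtain j where j: "P < j" "j \<le> P + 1 + card L" "j \<notin> f ` set a" by (auto simp: Suc_le_eq)
  define c where "c = filter (\<lambda>z. f z > j) a"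
  have indep: "I x y" if "x \<in> set a" "f x > j" "y \<in> set a" "\<not> f y > j" for x y
  proof (rule ccontr)
    assume d: "\<not> I x y"
    \<comment> \<open>The estimates \<open>full\<close> and \<open>short\<close> overlap at the
      value \<open>j\<close>; since \<open>f\<close> misses \<open>j\<close>, the inequality is
      strict and dependent letters cannot lie on different sides of the gap.\<close>
    have "f y < j" using that j(3) by (metis imageI linorder_neqE_nat)
    then show False
      using full[OF d, of j y] short[OF d, of j x] that by fastforce
  qed
  \<comment> \<open>No dependent pair is split by the gap, so in each projection \<open>c\<close>
    looks like the empty word or like \<open>a\<close>; in both cases it commutes with
    \<open>a\<close>.\<close>
  have c_proj: "proj x y c = [] \<or>
      proj x y c = proj x y a \<and> (\<exists>z. (z = x \<or> z = y) \<and> z \<in> set a \<and> f z > j)"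
    if "\<not> I x y" for x y
  proof (cases "proj x y c = []")
    case False
    then obtain z where "z \<in> set (proj x y c)" by (meson last_in_set)
    then have z: "z = x \<or> z = y" "z \<in> set a" "f z > j" by (auto simp: set_proj c_def)
    have "f z' > j" if "z' \<in> set a" "z' = x \<or> z' = y" for z'
      using indep[of z z'] z that \<open>\<not> I x y\<close> I_sym by blast
    then have "proj x y c = proj x y a"
      unfolding proj_def c_def filter_filter by (intro filter_cong) auto
    then show ?thesis using z by blast
  qed simp
  have "teq (a @ c) (c @ a)"
    unfolding teq_def using c_proj by fastforce
  moreover have "prefix (proj x y (wpow P c)) (proj x y s)" if d: "\<not> I x y" for x y
    using c_proj[OF d]
  proof
    assume "proj x y c = []"
    then show ?thesis by (simp add: proj_wpow)
  next
    assume "proj x y c = proj x y a \<and> (\<exists>z. (z = x \<or> z = y) \<and> z \<in> set a \<and> f z > j)"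
    then obtain z where z: "proj x y c = proj x y a" "z \<in> set a" "f z > j" "z = x \<or> z = y"
      by blast
    then have "P * length (proj x y a) \<le> length (proj x y s)"
      using short[OF d, of P z] j(1) by fastforce
    then show ?thesis
      using prefix_wpow_cases[OF pre[OF d], of P] z(1) by (simp add: proj_wpow)
  qed
  then have "\<exists>r. teq s (wpow P c @ r)" by (rule trace_prefix)
  moreover have "x0 \<in> set c" using x0 j(2) by (auto simp: c_def)
  moreover have "set c \<subseteq> set a" by (auto simp: c_def)
  ultimately show thesis using that[of c] by (metis empty_iff empty_set)
qed

end


section \<open>Partial actions of right-angled Artin groups\<close>

text \<open>The action is partial: a letter need not label an edge at a given vertex.
  \<open>E_swap\<close> requires only that a path reading commuting letters in one order can be
  replaced by one reading them in the other order. With \<open>E_iv\<close> and \<open>E_det\<close>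
  this makes the words of paths with given end points closed under \<open>red\<close>.\<close>

locale raag_action = raag_words iv I
  for iv :: "'l \<Rightarrow> 'l" and I :: "'l \<Rightarrow> 'l \<Rightarrow> bool" +
  fixes V :: "'v set" and L :: "'l set" and E :: "'v \<Rightarrow> 'l \<Rightarrow> 'v \<Rightarrow> bool"
  assumes finite_V: "finite V" and finite_L: "finite L"
    and E_carrier: "E v x u \<Longrightarrow> u \<in> V \<and> x \<in> L \<and> iv x \<noteq> x"
    and E_det: "E v x u \<Longrightarrow> E v x u' \<Longrightarrow> u = u'"
    and E_iv: "E v x u \<Longrightarrow> E u (iv x) v"
    and E_swap: "E v x u \<Longrightarrow> E u y t \<Longrightarrow> I x y \<Longrightarrow> \<exists>u'. E v y u' \<and> E u' x t"
begin

fun run :: "'v \<Rightarrow> 'l list \<Rightarrow> 'v \<Rightarrow> bool" where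
  "run v [] u \<longleftrightarrow> v = u"
| "run v (x # w) u \<longleftrightarrow> (\<exists>t. E v x t \<and> run t w u)"

lemma run_append: "run v (w @ w') u \<longleftrightarrow> (\<exists>t. run v w t \<and> run t w' u)"
  by (induction w arbitrary: v) auto

lemma run_in_V: "run v w u \<Longrightarrow> v \<in> V \<Longrightarrow> u \<in> V"
  by (induction w arbitrary: v) (use E_carrier in fastforce)+

lemma run_letters: "run v w u \<Longrightarrow> x \<in> set w \<Longrightarrow> x \<in> L \<and> iv x \<noteq> x"
  by (induction w arbitrary: v) (use E_carrier in fastforce)+

lemma run_winv: "run v w u \<Longrightarrow> run u (winv w) v"
  by (induction w arbitrary: v) (use E_iv in \<open>force simp: run_append\<close>)+

lemma run_red:
  assumes "red w w'" "run v w u" shows "run v w' u"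
  using assms
proof (induction rule: rtranclp_induct)
  case (step w' w'')
  from step.hyps(2) step.IH[OF step.prems] show ?case
  proof (induction rule: step.induct)
    case (swap x y p q)
    then show ?case using E_swap[of _ x _ y] by (fastforce simp: run_append)
  next
    case (cancel p x q)
    then obtain t s r where "run v p t" "E t x s" "E s (iv x) r" "run r q u"
      by (auto simp: run_append)
    moreover from this have "r = t" using E_iv E_det by blast
    ultimately show ?case by (auto simp: run_append)
  qed
qed

lemma run_teq: "teq w w' \<Longrightarrow> run v w u \<Longrightarrow> run v w' u"
  using teq_imp_red run_red by blast

text \<open>The run can be cut before, between and after the factors. These are more than
  \<open>card V\<close> places, so two of them lie at the same vertex.\<close>

lemma run_pigeonhole:
  assumes "run v (concat ws) u" "v \<in> V" "card V \<le> length ws"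
  obtains i j where "i < j" "j \<le> length ws" "run v (concat (take i ws) @ concat (drop j ws)) u"
proof -
  have "\<exists>s. run v (concat (take i ws)) s \<and> run s (concat (drop i ws)) u" for i
    using assms(1) by (metis append_take_drop_id concat_append run_append)
  then obtain s where s: "\<And>i. run v (concat (take i ws)) (s i)" "\<And>i. run (s i) (concat (drop i ws)) u"
    by metis
  have "s ` {..length ws} \<subseteq> V" using s(1) run_in_V assms(2) by blast
  then have "card (s ` {..length ws}) \<le> card V" using finite_V by (intro card_mono)
  then have "\<not> inj_on s {..length ws}" using assms(3) card_image by fastforce
  then obtain i j where "i < j" "j \<le> length ws" "s i = s j"
    unfolding inj_on_def by (metis atMost_iff linorder_neqE_nat)
  then show thesis using that s run_append by metis
qed

lemma short_run:
  assumes "run v t u" "v \<in> V"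
  shows "\<exists>t'. run v t' u \<and> set t' \<subseteq> set t \<and> length t' \<le> card V"
  using assms
proof (induction t rule: length_induct)
  case (1 t)
  show ?case
  proof (cases "length t \<le> card V")
    case True
    then show ?thesis using 1 by blast
  next
    case False
    let ?ws = "map (\<lambda>x. [x]) t"
    have cc: "concat (map (\<lambda>x. [x]) w) = w" for w :: "'l list" by (induction w) auto
    obtain i j where ij: "i < j" "j \<le> length ?ws"
      "run v (concat (take i ?ws) @ concat (drop j ?ws)) u"
      using run_pigeonhole[of v ?ws u] 1 False cc by auto
    then have "run v (take i t @ drop j t) u" by (simp add: take_map drop_map cc)
    moreover have "length (take i t @ drop j t) < length t" using ij by simp
    ultimately obtain t' where
      "run v t' u" "set t' \<subseteq> set (take i t @ drop j t)" "length t' \<le> card V"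
      using 1 by blast
    moreover have "set (take i t @ drop j t) \<subseteq> set t"
      using set_take_subset set_drop_subset by fastforce
    ultimately show ?thesis by blast
  qed
qed

text \<open>This is the threshold of \<open>periodic_prefix\<close> for \<open>P = card V\<close>,
  the number of copies of the periodic factor that force a repeated vertex.\<close>

definition conj_const :: nat where
  "conj_const = card V + card L + 2"

text \<open>Cutting out copies of \<open>c\<close> preserves the equation because powers of
  \<open>c\<close> commute with \<open>a\<close>: cancelling all of them leaves
  \<open>a r = r b\<close>, and any number of copies can be put back in front.\<close>

lemma short_cyclic:
  assumes "run v s u" "v \<in> V" "teq (a @ s) (s @ b)" "set s \<subseteq> set a" "set a \<subseteq> L"
  shows "\<exists>s'. run v s' u \<and> teq (a @ s') (s' @ b) \<and> length s' \<le> conj_const * length a"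
  using assms
proof (induction s rule: length_induct)
  case (1 s)
  show ?case
  proof (cases "length s \<le> conj_const * length a")
    case True
    then show ?thesis using 1 by blast
  next
    case False
    then obtain c r where c: "c \<noteq> []" "set c \<subseteq> set a" "teq (a @ c) (c @ a)"
      and s: "teq s (wpow (card V) c @ r)"
      using periodic_prefix[OF 1(4) 1(5) finite_L 1(6), of "card V"] unfolding conj_const_def
      by (metis not_le_imp_less)
    obtain t where t: "run v (wpow (card V) c) t" "run t r u"
      using run_teq[OF s] 1(2) run_append by blast
    obtain i j where ij: "i < j" "j \<le> card V"
      "run v (concat (take i (replicate (card V) c)) @ concat (drop j (replicate (card V) c))) t"
      using run_pigeonhole[OF t(1) 1(3)] by auto
    define k where "k = i + (card V - j)"
    have k: "run v (wpow k c) t" "k < card V"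
      using ij unfolding k_def wpow_add by (simp_all add: min_def split: if_splits)
    have ck: "teq (a @ wpow n c) (wpow n c @ a)" for n
      using teq_wpow_conj[OF teq_sym[OF c(3)], of n] teq_sym by blast
    have ckr: "teq (a @ wpow n c @ r) (wpow n c @ a @ r)" for n
      using teq_append[OF ck teq_refl, of n r] by simp
    have "teq (wpow (card V) c @ a @ r) (a @ wpow (card V) c @ r)"
      using ckr teq_sym by blast
    also have "teq \<dots> (a @ s)" using s teq_sym by (intro teq_append[OF teq_refl]) blast
    also have "teq \<dots> (s @ b)" by (rule 1(4))
    also have "teq \<dots> (wpow (card V) c @ r @ b)" using teq_append[OF s teq_refl, of b] by simp
    finally have ar: "teq (a @ r) (r @ b)" by (simp only: teq_cancel_left)
    let ?s = "wpow k c @ r"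
    have "teq (a @ ?s) (wpow k c @ (a @ r))" using ckr by simp
    also have "teq \<dots> (wpow k c @ (r @ b))" using ar by (intro teq_append[OF teq_refl])
    finally have "teq (a @ ?s) (?s @ b)" by simp
    moreover have "length ?s < length s"
      using teq_length[OF s] k(2) c(1) by (simp add: length_wpow)
    moreover have "set ?s \<subseteq> set a" using teq_set[OF s] 1(5) c(2) by auto
    moreover have "run v ?s u" using k(1) t(2) run_append by blast
    ultimately show ?thesis using 1 by blast
  qed
qed

text \<open>Each conjugation by an end letter moves the base point along an edge, so
  \<open>a'\<close> is a loop at the end point \<open>u\<close> of \<open>p\<close>. The factor 2
  records that every letter of \<open>p\<close> is removed from both ends of the word.\<close>

lemma cyclic_reduction:
  assumes "run v a v"
  shows "\<exists>p a' u. run v p u \<and> run u a' u \<and> eqv (a @ p) (p @ a') \<and> reduced (a' @ a') \<and>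
    2 * length p + length a' \<le> length a"
  using assms
proof (induction a arbitrary: v rule: length_induct)
  case (1 a)
  consider "\<not> reduced a" | "reduced (a @ a)" | "reduced a" "\<not> reduced (a @ a)" by blast
  then show ?case
  proof cases
    case 1
    then have "length (nf a) < length a"
      using length_nf length_nf_eq_imp_reduced le_neq_implies_less by blast
    moreover have "run v (nf a) v" using red_nf run_red "1.prems" by blast
    ultimately obtain p a' u where p: "run v p u" "run u a' u" "eqv (nf a @ p) (p @ a')"
      "reduced (a' @ a')" "2 * length p + length a' \<le> length (nf a)"
      using "1.IH" by blast
    have "eqv (a @ p) (p @ a')"
      using p(3) eqv_append[OF eqv_nf eqv_refl, of a p] eqv_trans by blast
    then show ?thesis using p length_nf[of a] le_trans by blast
  next
    case 2
    then have "run v [] v \<and> run v a v \<and> eqv (a @ []) ([] @ a) \<and> reduced (a @ a) \<and>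
      2 * length ([] :: 'l list) + length a \<le> length a"
      using "1.prems" by simp
    then show ?thesis by blast
  next
    case 3
    obtain x w where x: "teq a (iv x # w @ [x])"
      using not_cyclically_reduced[OF 3] run_letters[OF "1.prems"] by blast
    then have "run v (iv x # w @ [x]) v" using run_teq "1.prems" by blast
    then obtain t t' where t: "E v (iv x) t" "run t w t'" "E t' x v" by (auto simp: run_append)
    \<comment> \<open>The first edge and the reverse of the last edge issue from \<open>v\<close>
      with the same label.\<close>
    then have "t' = t" using E_iv E_det by blast
    then have "run t w t" using t by simp
    moreover have la: "length a = length w + 2" using teq_length[OF x] by simp
    ultimately obtain p a' u where p: "run t p u" "run u a' u" "eqv (w @ p) (p @ a')"
      "reduced (a' @ a')" "2 * length p + length a' \<le> length w"
      using "1.IH" by (metis less_add_same_cancel1 zero_less_numeral)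
    have "eqv (a @ (iv x # p)) ((iv x # w @ [x]) @ (iv x # p))"
      by (intro eqv_append teq_imp_eqv x) simp
    also have "eqv ((iv x # w @ [x]) @ (iv x # p)) ((iv x # w) @ p)"
      using red_imp_eqv[OF r_into_rtranclp[of step, OF cancel[of "iv x # w" x p]]] by simp
    also have "eqv ((iv x # w) @ p) ([iv x] @ (p @ a'))"
      using eqv_append[OF eqv_refl p(3), of "[iv x]"] by simp
    finally have "eqv (a @ (iv x # p)) ((iv x # p) @ a')" by simp
    moreover have "run v (iv x # p) u" using t(1) p(1) by auto
    moreover have "2 * length (iv x # p) + length a' \<le> length a" using p(5) la by simp
    ultimately show ?thesis using p(2,4) by blast
  qed
qed

lemma eqv_move_left:
  assumes "eqv (a @ p) (p @ a')" shows "eqv (a' @ winv p) (winv p @ a)"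
proof -
  have "eqv (a' @ winv p) ((winv p @ p) @ (a' @ winv p))"
    using eqv_append[OF eqv_sym[OF eqv_winv_left] eqv_refl, of "a' @ winv p"] by simp
  also have "eqv ((winv p @ p) @ (a' @ winv p)) (winv p @ (a @ p) @ winv p)"
    using eqv_context[OF eqv_sym[OF assms], of "winv p" "winv p"] by simp
  also have "eqv (winv p @ (a @ p) @ winv p) (winv p @ a)"
    using eqv_append[OF eqv_refl eqv_winv_right, of "winv p @ a" p] by simp
  finally show ?thesis .
qed

theorem short_conjugator:
  assumes v: "v \<in> V" and a: "run v a v" and b: "run v b v" and g: "run v g v"
    and ag: "eqv (a @ g) (g @ b)"
  shows "\<exists>g'. run v g' v \<and> eqv (a @ g') (g' @ b) \<and>
    length g' \<le> (conj_const + 1) * (length a + length b) + card V"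
proof -
  obtain p a' u1 where p: "run v p u1" "run u1 a' u1" "eqv (a @ p) (p @ a')"
    "reduced (a' @ a')" "2 * length p + length a' \<le> length a"
    using cyclic_reduction[OF a] by blast
  obtain r b' u2 where r: "run v r u2" "run u2 b' u2" "eqv (b @ r) (r @ b')"
    "reduced (b' @ b')" "2 * length r + length b' \<le> length b"
    using cyclic_reduction[OF b] by blast
  \<comment> \<open>Cyclic reduction has moved the two base points independently, so
    \<open>h\<close> conjugates as a path from \<open>u1\<close> to \<open>u2\<close>; both end
    points must be kept from now on.\<close>
  define h where "h = winv p @ g @ r"
  have u1: "u1 \<in> V" using run_in_V[OF p(1) v] .
  have h: "run u1 h u2" unfolding h_def using run_winv[OF p(1)] g r(1) run_append by blast
  have "eqv ((a' @ winv p) @ (g @ r)) ((winv p @ a) @ (g @ r))"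
    by (intro eqv_append eqv_move_left p(3) eqv_refl)
  also have "eqv ((winv p @ a) @ (g @ r)) (winv p @ (g @ b) @ r)"
    using eqv_context[OF ag, of "winv p" r] by simp
  also have "eqv (winv p @ (g @ b) @ r) ((winv p @ g) @ (r @ b'))"
    using eqv_append[OF eqv_refl r(3), of "winv p @ g"] by simp
  finally have "eqv (a' @ h) (h @ b')" by (simp add: h_def)
  then obtain m h' where h': "red (wpow m a' @ h) h'" "teq (a' @ h') (h' @ b')"
    by (rule trace_conjugator[OF p(4) r(4)])
  \<comment> \<open>The powers of \<open>a'\<close> added in front are loops at \<open>u1\<close>
    and do not change the end points of the path.\<close>
  have "run u1 (wpow m a') u1" by (induction m) (use p(2) run_append in auto)
  then have "run u1 h' u2" using run_red[OF h'(1)] h run_append by blast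
  moreover obtain s t where st: "teq h' (s @ t)" "teq (a' @ s) (s @ b')" "set s \<subseteq> set a'"
    "\<And>x y. x \<in> set t \<Longrightarrow> y \<in> set b' \<Longrightarrow> I x y"
    using split_conjugator[OF h'(2)] by metis
  ultimately obtain u0 where u0: "run u1 s u0" "run u0 t u2" using run_teq run_append by blast
  have "set a' \<subseteq> L" using run_letters[OF p(2)] by blast
  then obtain s' where s': "run u1 s' u0" "teq (a' @ s') (s' @ b')"
    "length s' \<le> conj_const * length a'"
    using short_cyclic[OF u0(1) u1 st(2,3)] by blast
  obtain t' where t': "run u0 t' u2" "set t' \<subseteq> set t" "length t' \<le> card V"
    using short_run[OF u0(2)] run_in_V[OF u0(1) u1] by blast
  \<comment> \<open>Cutting loops out of \<open>t\<close> introduces no new letters, so the result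
    still commutes with \<open>b'\<close>.\<close>
  have "teq (t' @ b') (b' @ t')" using t'(2) st(4) by (intro teq_commute) blast
  then have tb: "eqv (b' @ t') (t' @ b')" by (rule teq_imp_eqv[OF teq_sym])
  define g' where "g' = p @ s' @ t' @ winv r"
  have "eqv ((a @ p) @ (s' @ t' @ winv r)) ((p @ a') @ (s' @ t' @ winv r))"
    by (intro eqv_append p(3) eqv_refl)
  also have "eqv \<dots> (p @ (s' @ b') @ (t' @ winv r))"
    using eqv_context[OF teq_imp_eqv[OF s'(2)], of p "t' @ winv r"] by simp
  also have "eqv \<dots> ((p @ s') @ (t' @ b') @ winv r)"
    using eqv_context[OF tb, of "p @ s'" "winv r"] by simp
  also have "eqv \<dots> ((p @ s' @ t') @ (winv r @ b))"
    using eqv_append[OF eqv_refl eqv_move_left[OF r(3)], of "p @ s' @ t'"] by simp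
  finally have "eqv (a @ g') (g' @ b)" by (simp add: g'_def)
  moreover have "run v g' v"
    unfolding g'_def using p(1) s'(1) t'(1) run_winv[OF r(1)] run_append by blast
  moreover have "length g' \<le> (conj_const + 1) * (length a + length b) + card V"
  proof -
    have "length g' \<le> length p + conj_const * length a' + card V + length r"
      using s'(3) t'(3) by (simp add: g'_def)
    also have "\<dots> \<le> length a + conj_const * length a + card V + length b"
      using p(5) r(5) by (intro add_mono mult_le_mono) simp_all
    also have "\<dots> \<le> (conj_const + 1) * (length a + length b) + card V"
      by (simp add: algebra_simps)
    finally show ?thesis .
  qed
  ultimately show ?thesis by blast
qed

end


section \<open>Special cube complexes\<close>

locale compact_special_complex =
  fixes X :: "'q cube_complex"
  assumes special: "special X" and compact: "compact_complex X"
begin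

section \<open>Edges, squares and their symmetries\<close>

lemmas is_cube_complex = special[unfolded special_def cube_complex_def, THEN conjunct1]

lemma restr_face:
  assumes "q \<in> cubes X" "cdim X q = n" "face_embedding m n e"
  shows "restr X q e \<in> {c \<in> cubes X. cdim X c = m}"
  using is_cube_complex[THEN conjunct1] assms by simp

lemma restr_restr:
  assumes "q \<in> cubes X" "cdim X q = n" "face_embedding m n e" "face_embedding l m e'"
  shows "restr X (restr X q e) e' = restr X q (comp_embedding e e')"
  using is_cube_complex[THEN conjunct2, THEN conjunct2, THEN conjunct1] assms by blast

lemma restr_id: "q \<in> cubes X \<Longrightarrow> restr X q (id_embedding (cdim X q)) = q"
  using is_cube_complex[THEN conjunct2, THEN conjunct1] by blast

lemma lessThan_small: "{..<1 :: nat} = {0}" "{..<2 :: nat} = {0, 1}"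
  by auto

lemma embeddings:
  "face_embedding 0 1 [Const b]"
  "face_embedding 1 1 [Coord 0 s]"
  "face_embedding 1 2 [Coord 0 s, Const b]"
  "face_embedding 1 2 [Const b, Coord 0 s]"
  "face_embedding 2 2 [Coord 0 s, Coord 1 t]"
  "face_embedding 2 2 [Coord 1 s, Coord 0 t]"
  unfolding face_embedding_def lessThan_small by auto

lemma edge_rev:
  assumes "a \<in> oriented_edges X"
  shows "rev_edge X a \<in> oriented_edges X" "rev_edge X (rev_edge X a) = a"
    "src X (rev_edge X a) = tgt X a" "tgt X (rev_edge X a) = src X a"
    "src X a \<in> vertices X" "tgt X a \<in> vertices X"
proof -
  have a: "a \<in> cubes X" "cdim X a = 1" using assms by (auto simp: oriented_edges_def)
  show "rev_edge X a \<in> oriented_edges X" "src X a \<in> vertices X" "tgt X a \<in> vertices X"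
    unfolding rev_edge_def oriented_edges_def src_def tgt_def vertices_def
    using restr_face[OF a] embeddings(1,2) by blast+
  have "restr X (rev_edge X a) [Coord 0 True] = restr X a (id_embedding 1)"
    unfolding rev_edge_def
    by (subst restr_restr[OF a embeddings(2) embeddings(2)])
      (simp add: comp_embedding_def id_embedding_def)
  then show "rev_edge X (rev_edge X a) = a"
    using restr_id[OF a(1)] a(2) by (simp add: rev_edge_def)
  show "src X (rev_edge X a) = tgt X a" "tgt X (rev_edge X a) = src X a"
    unfolding src_def tgt_def rev_edge_def
    by (subst restr_restr[OF a embeddings(2) embeddings(1)], simp add: comp_embedding_def)+
qed

definition flip_square :: "'q \<Rightarrow> 'q" where
  "flip_square q = restr X q [Coord 0 True, Coord 1 False]"

definition swap_square :: "'q \<Rightarrow> 'q" where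
  "swap_square q = restr X q [Coord 1 False, Coord 0 False]"

context
  fixes q assumes q: "q \<in> squares X"
begin

lemma square_cube: "q \<in> cubes X" "cdim X q = 2"
  using q by (auto simp: squares_def)

lemmas square_restr = restr_restr[OF square_cube]

lemma square_sides:
  "bottom_side X q \<in> oriented_edges X" "top_side X q \<in> oriented_edges X"
  "left_side X q \<in> oriented_edges X" "right_side X q \<in> oriented_edges X"
  unfolding bottom_side_def top_side_def left_side_def right_side_def oriented_edges_def
  using restr_face[OF square_cube] embeddings(3,4) by blast+

lemma square_corners:
  "src X (bottom_side X q) = src X (left_side X q)"
  "tgt X (bottom_side X q) = src X (right_side X q)"
  "tgt X (left_side X q) = src X (top_side X q)"
  "tgt X (top_side X q) = tgt X (right_side X q)"
  unfolding src_def tgt_def bottom_side_def top_side_def left_side_def right_side_def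
  by (simp_all add: square_restr[OF embeddings(3) embeddings(1)]
      square_restr[OF embeddings(4) embeddings(1)] comp_embedding_def)

lemma square_symmetries:
  "flip_square q \<in> squares X" "swap_square q \<in> squares X"
  unfolding flip_square_def swap_square_def squares_def
  using restr_face[OF square_cube] embeddings(5,6) by blast+

lemma flip_sides:
  "bottom_side X (flip_square q) = rev_edge X (bottom_side X q)"
  "top_side X (flip_square q) = rev_edge X (top_side X q)"
  "left_side X (flip_square q) = right_side X q"
  "right_side X (flip_square q) = left_side X q"
  unfolding flip_square_def rev_edge_def bottom_side_def top_side_def left_side_def right_side_def
  by (simp_all add: square_restr[OF embeddings(5) embeddings(3)]
      square_restr[OF embeddings(5) embeddings(4)]
      square_restr[OF embeddings(3) embeddings(2)] comp_embedding_def del: One_nat_def)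

lemma swap_sides:
  "bottom_side X (swap_square q) = left_side X q"
  "top_side X (swap_square q) = right_side X q"
  "left_side X (swap_square q) = bottom_side X q"
  "right_side X (swap_square q) = top_side X q"
  unfolding swap_square_def bottom_side_def top_side_def left_side_def right_side_def
  by (simp_all add: square_restr[OF embeddings(6) embeddings(3)]
      square_restr[OF embeddings(6) embeddings(4)] comp_embedding_def del: One_nat_def)

lemma corner_edges_square: "corner_edges X q = [bottom_side X q, left_side X q]"
  by (simp add: corner_edges_def square_cube(2) bottom_side_def left_side_def numeral_2_eq_2)

end

lemma parallel_edges: "parallel X a b \<Longrightarrow> a \<in> oriented_edges X \<and> b \<in> oriented_edges X"
  by (induction rule: parallel.induct) (auto simp: square_sides)

lemma parallel_rev: "parallel X a b \<Longrightarrow> parallel X (rev_edge X a) (rev_edge X b)"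
proof (induction rule: parallel.induct)
  case (refl a)
  then show ?case by (simp add: parallel.refl edge_rev(1))
next
  case (opposite q)
  then show ?case
    using parallel.opposite[OF square_symmetries(1)] by (simp add: flip_sides)
next
  case (sym a b)
  show ?case by (rule parallel.sym[OF sym.IH])
next
  case (trans a b c)
  show ?case by (rule parallel.trans[OF trans.IH])
qed

lemma parallel_left_right: "q \<in> squares X \<Longrightarrow> parallel X (left_side X q) (right_side X q)"
  using parallel.opposite[OF square_symmetries(2)] by (simp add: swap_sides)

text \<open>The letters are the parallelism classes of oriented edges, that is, the hyperplanes with a
  choice of one of their two sides.\<close>

definition lab :: "'q \<Rightarrow> 'q set" where
  "lab a = {b. parallel X a b}"

definition labs :: "'q set set" where
  "labs = lab ` oriented_edges X"

text \<open>The identity outside \<open>labs\<close> makes this an involution on the whole type, as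
  \<open>raag_words\<close> demands.\<close>

definition inv_lab :: "'q set \<Rightarrow> 'q set" where
  "inv_lab A = (if A \<in> labs then rev_edge X ` A else A)"

definition lab_cross :: "'q set \<Rightarrow> 'q set \<Rightarrow> bool" where
  "lab_cross A B \<longleftrightarrow> (\<exists>q\<in>squares X. lab (bottom_side X q) = A \<and> lab (left_side X q) = B)"

definition lab_edge :: "'q \<Rightarrow> 'q set \<Rightarrow> 'q \<Rightarrow> bool" where
  "lab_edge v A u \<longleftrightarrow> (\<exists>a\<in>oriented_edges X. src X a = v \<and> tgt X a = u \<and> lab a = A)"

lemma lab_self: "a \<in> oriented_edges X \<Longrightarrow> a \<in> lab a"
  by (simp add: lab_def parallel.refl)

lemma lab_eq:
  assumes "a \<in> oriented_edges X" shows "lab a = lab b \<longleftrightarrow> parallel X a b"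
proof
  assume "lab a = lab b"
  then have "parallel X b a" using lab_self[OF assms] by (simp add: lab_def)
  then show "parallel X a b" by (rule parallel.sym)
next
  assume ab: "parallel X a b"
  then have "parallel X b a" by (rule parallel.sym)
  then show "lab a = lab b" unfolding lab_def using ab parallel.trans[of X] by blast
qed

lemma inv_lab:
  assumes "a \<in> oriented_edges X" shows "inv_lab (lab a) = lab (rev_edge X a)"
proof -
  have "rev_edge X ` lab a = lab (rev_edge X a)"
  proof (intro subset_antisym subsetI)
    fix c assume "c \<in> lab (rev_edge X a)"
    then have "parallel X (rev_edge X (rev_edge X a)) (rev_edge X c)" "c \<in> oriented_edges X"
      using parallel_rev parallel_edges by (auto simp: lab_def)
    then show "c \<in> rev_edge X ` lab a"
      using edge_rev(2) assms by (intro image_eqI[of _ _ "rev_edge X c"]) (simp_all add: lab_def)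
  qed (auto simp: lab_def parallel_rev)
  then show ?thesis using assms by (simp add: inv_lab_def labs_def)
qed

lemma hyperplane_labs: "hyperplane X a = lab a \<union> lab (rev_edge X a)"
  by (auto simp: hyperplane_def lab_def)

lemma hyperplane_in: "a \<in> oriented_edges X \<Longrightarrow> hyperplane X a \<in> hyperplanes X"
  by (simp add: hyperplanes_def)

lemma lab_cross_hyperplanes:
  assumes "lab_cross (lab a) (lab b)"
  shows "hyperplanes_cross X (hyperplane X a) (hyperplane X b)"
proof -
  obtain q where "q \<in> squares X" "lab (bottom_side X q) = lab a" "lab (left_side X q) = lab b"
    using assms by (auto simp: lab_cross_def)
  then show ?thesis
    unfolding hyperplanes_cross_def hyperplane_labs using lab_self square_sides by blast
qed

lemma not_self_cross: "a \<in> oriented_edges X \<Longrightarrow> \<not> hyperplanes_cross X (hyperplane X a) (hyperplane X a)"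
  using special hyperplane_in unfolding special_def by blast

lemma lab_cross_sym: "lab_cross A B \<Longrightarrow> lab_cross B A"
  unfolding lab_cross_def using square_symmetries(2) swap_sides by metis

lemma lab_cross_inv:
  assumes "lab_cross A B" shows "lab_cross (inv_lab A) B"
proof -
  obtain q where q: "q \<in> squares X" "lab (bottom_side X q) = A" "lab (left_side X q) = B"
    using assms by (auto simp: lab_cross_def)
  have "lab (left_side X (flip_square q)) = B"
    using q parallel_left_right lab_eq square_sides flip_sides by metis
  moreover have "lab (bottom_side X (flip_square q)) = inv_lab A"
    using q inv_lab square_sides flip_sides by metis
  ultimately show ?thesis unfolding lab_cross_def using q(1) square_symmetries by blast
qed

lemma inv_lab_inv_lab: "inv_lab (inv_lab A) = A"
proof (cases "A \<in> labs")
  case True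
  then obtain a where "a \<in> oriented_edges X" "A = lab a" by (auto simp: labs_def)
  then show ?thesis by (simp add: inv_lab edge_rev)
qed (simp add: inv_lab_def)

text \<open>Two different parallel edges issuing from one vertex either osculate, which is a direct
  self-osculation, or are adjacent sides of a square, and then their hyperplane crosses
  itself.\<close>

lemma edge_unique:
  assumes "a \<in> oriented_edges X" "b \<in> oriented_edges X" "src X a = src X b" "lab a = lab b"
  shows "a = b"
proof (rule ccontr)
  assume "a \<noteq> b"
  have par: "parallel X a b" using assms lab_eq by blast
  have "\<not> directly_self_osculates X (hyperplane X a)"
    using special hyperplane_in[OF assms(1)] unfolding special_def by blast
  moreover have "a \<in> hyperplane X a" "b \<in> hyperplane X a"
    using par assms lab_self by (auto simp: hyperplane_labs)
  ultimately have "adjacent_in_link X a b"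
    using par assms(3) \<open>a \<noteq> b\<close> unfolding directly_self_osculates_def edges_osculate_def by blast
  then obtain q where "q \<in> squares X" "bottom_side X q = a" "left_side X q = b"
    unfolding adjacent_in_link_def using corner_edges_square by auto
  then have "lab_cross (lab a) (lab a)" using assms(4) by (auto simp: lab_cross_def)
  then show False using lab_cross_hyperplanes not_self_cross assms(1) by blast
qed

text \<open>After reversing \<open>a\<close> both edges issue from the same vertex. Their
  hyperplanes cross, hence are distinct and do not osculate, so the edges span a corner of a square;
  flipping that square restores the direction of \<open>a\<close>.\<close>

lemma square_completion:
  assumes a: "a \<in> oriented_edges X" and b: "b \<in> oriented_edges X"
    and ab: "tgt X a = src X b" and cross: "lab_cross (lab a) (lab b)"
  obtains q where "q \<in> squares X" "bottom_side X q = a" "right_side X q = b"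
proof -
  define c where "c = rev_edge X a"
  have c: "c \<in> oriented_edges X" "rev_edge X c = a" "src X c = src X b"
    using edge_rev[OF a] ab by (simp_all add: c_def)
  have "lab_cross (lab c) (lab b)" using lab_cross_inv[OF cross] inv_lab[OF a] by (simp add: c_def)
  then have hc: "hyperplanes_cross X (hyperplane X c) (hyperplane X b)"
    by (rule lab_cross_hyperplanes)
  then have ne: "hyperplane X c \<noteq> hyperplane X b" using not_self_cross c(1) by metis
  then have "\<not> hyperplanes_osculate X (hyperplane X c) (hyperplane X b)"
    using special hc hyperplane_in c(1) b unfolding special_def by blast
  moreover have "c \<in> hyperplane X c" "b \<in> hyperplane X b"
    using lab_self c(1) b by (auto simp: hyperplane_labs)
  moreover have "c \<noteq> b" using ne by blast
  ultimately have "adjacent_in_link X c b"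
    using c(3) unfolding hyperplanes_osculate_def edges_osculate_def by blast
  then obtain q where "q \<in> squares X" "bottom_side X q = c" "left_side X q = b"
    unfolding adjacent_in_link_def using corner_edges_square by auto
  then show thesis using that[of "flip_square q"] square_symmetries flip_sides c(2) by simp
qed

text \<open>The clauses of specialness become axioms of the action: no self-crossing gives
  irreflexivity of \<open>lab_cross\<close>, two-sidedness gives
  \<open>inv_lab x \<noteq> x\<close>, the ban on direct self-osculation gives \<open>E_det\<close>
  through \<open>edge_unique\<close>, and the ban on crossing hyperplanes that osculate gives
  \<open>E_swap\<close> through \<open>square_completion\<close>.\<close>

sublocale raag_action inv_lab lab_cross "vertices X" labs lab_edge
proof
  show "finite (vertices X)" "finite labs"
    using compact
    by (auto simp: compact_complex_def vertices_def labs_def oriented_edges_def)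
  show "inv_lab (inv_lab x) = x" for x by (rule inv_lab_inv_lab)
  show "lab_cross x y \<Longrightarrow> lab_cross y x" for x y by (rule lab_cross_sym)
  show "lab_cross x y \<Longrightarrow> lab_cross (inv_lab x) y" for x y by (rule lab_cross_inv)
  show "\<not> lab_cross x x" for x
  proof
    assume x: "lab_cross x x"
    then obtain q where "q \<in> squares X" "lab (bottom_side X q) = x" unfolding lab_cross_def by blast
    then show False using x lab_cross_hyperplanes not_self_cross square_sides by blast
  qed
  fix v x u assume e: "lab_edge v x u"
  then obtain a where a: "a \<in> oriented_edges X" "src X a = v" "tgt X a = u" "lab a = x"
    by (auto simp: lab_edge_def)
  have "\<not> parallel X a (rev_edge X a)"
    using special hyperplane_in[OF a(1)] lab_self[OF a(1)]
    unfolding special_def two_sided_def hyperplane_labs by blast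
  then show "u \<in> vertices X \<and> x \<in> labs \<and> inv_lab x \<noteq> x"
    using a edge_rev inv_lab lab_eq[of a "rev_edge X a"] by (auto simp: labs_def)
  show "lab_edge u (inv_lab x) v"
    using a edge_rev inv_lab unfolding lab_edge_def by metis
  show "u = u'" if "lab_edge v x u'" for u'
    using that a edge_unique unfolding lab_edge_def by blast
  show "\<exists>u'. lab_edge v y u' \<and> lab_edge u' x t" if "lab_edge u y t" "lab_cross x y" for y t
  proof -
    obtain b where b: "b \<in> oriented_edges X" "src X b = u" "tgt X b = t" "lab b = y"
      using \<open>lab_edge u y t\<close> by (auto simp: lab_edge_def)
    obtain q where q: "q \<in> squares X" "bottom_side X q = a" "right_side X q = b"
      using square_completion[of a b] a b \<open>lab_cross x y\<close> by metis
    have "lab (left_side X q) = y" "lab (top_side X q) = x"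
      using q a b lab_eq parallel_left_right parallel.opposite square_sides by metis+
    then have "lab_edge v y (tgt X (left_side X q))" "lab_edge (tgt X (left_side X q)) x t"
      unfolding lab_edge_def using q a b square_sides square_corners by metis+
    then show ?thesis by blast
  qed
qed


subsection \<open>Edge paths and words\<close>

lemma edge_path_vertices: "edge_path X u p v \<Longrightarrow> u \<in> vertices X \<and> v \<in> vertices X"
  by (induction p arbitrary: u) (auto simp: edge_rev)

lemma edge_path_append:
  "edge_path X u (p @ p') v \<longleftrightarrow> (\<exists>t. edge_path X u p t \<and> edge_path X t p' v)"
  by (induction p arbitrary: u) (auto dest: edge_path_vertices)

abbreviation word :: "'q list \<Rightarrow> 'q set list" where
  "word \<equiv> map lab"

lemma edge_path_run: "edge_path X u p v \<Longrightarrow> run u (word p) v"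
  by (induction p arbitrary: u) (auto simp: lab_edge_def)

lemma run_edge_path:
  "run u w v \<Longrightarrow> u \<in> vertices X \<Longrightarrow> \<exists>p. edge_path X u p v \<and> word p = w"
proof (induction w arbitrary: u)
  case (Cons x w)
  then obtain t where t: "lab_edge u x t" "run t w v" by auto
  then obtain a where a: "a \<in> oriented_edges X" "src X a = u" "run (tgt X a) w v" "lab a = x"
    unfolding lab_edge_def[of u x t] by blast
  then obtain p where "edge_path X (tgt X a) p v" "word p = w"
    using Cons.IH edge_rev by blast
  then show ?case using a by (intro exI[of _ "a # p"]) simp
qed simp

lemma edge_path_unique:
  "edge_path X u p v \<Longrightarrow> edge_path X u p' v' \<Longrightarrow> word p = word p' \<Longrightarrow> p = p'"
proof (induction p arbitrary: u p')
  case (Cons a p)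
  then obtain a' q where p': "p' = a' # q" by (cases p') auto
  then have "a = a'" using Cons.prems edge_unique by simp
  then show ?case using Cons p' by auto
qed simp

lemma homotopic_paths:
  "homotopic_edge_paths X u v p p' \<Longrightarrow> edge_path X u p v \<and> edge_path X u p' v"
proof (induction rule: homotopic_edge_paths.induct)
  case (square p q p')
  then show ?case by (auto simp: edge_path_append square_corners square_sides)
qed (auto simp: edge_path_append edge_rev)

lemma homotopic_imp_eqv: "homotopic_edge_paths X u v p p' \<Longrightarrow> eqv (word p) (word p')"
proof (induction rule: homotopic_edge_paths.induct)
  case (backtrack p a p')
  then have "lab (rev_edge X a) = inv_lab (lab a)" by (auto simp: edge_path_append inv_lab)
  then show ?case
    using red_imp_eqv[OF r_into_rtranclp[of step, OF cancel[of "word p" "lab a" "word p'"]]] by simp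
next
  case (square p q p')
  have "lab (left_side X q) = lab (right_side X q)" "lab (bottom_side X q) = lab (top_side X q)"
    using square lab_eq parallel_left_right parallel.opposite square_sides by metis+
  moreover from this have "lab_cross (lab (bottom_side X q)) (lab (right_side X q))"
    using square by (auto simp: lab_cross_def)
  ultimately show ?case
    using red_imp_eqv[OF r_into_rtranclp[of step, OF swap[of _ _ "word p" "word p'"]]] by simp
next
  case (sym p p')
  show ?case by (rule eqv_sym[OF sym.IH])
next
  case (trans p p' p'')
  show ?case by (rule eqv_trans[OF trans.IH])
qed simp

text \<open>A swap is a push across the square from \<open>square_completion\<close>. A cancelled
  pair is a backtrack, since \<open>edge_unique\<close> identifies its second edge with the reverse
  of the first.\<close>

lemma lift_step:
  assumes "step (word p) w" "edge_path X u p v"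
  shows "\<exists>p'. homotopic_edge_paths X u v p p' \<and> word p' = w"
  using assms(1)
proof cases
  case (swap x y w1 w2)
  then obtain p1 a b p2 where p: "p = p1 @ [a, b] @ p2" "word p1 = w1" "lab a = x" "lab b = y"
    "word p2 = w2"
    by (auto simp: map_eq_append_conv map_eq_Cons_conv)
  then have ab: "a \<in> oriented_edges X" "b \<in> oriented_edges X" "tgt X a = src X b"
    using assms(2) by (auto simp: edge_path_append)
  then obtain q where q: "q \<in> squares X" "bottom_side X q = a" "right_side X q = b"
    using square_completion swap(3) p by metis
  then have "homotopic_edge_paths X u v p (p1 @ [left_side X q, top_side X q] @ p2)"
    using homotopic_edge_paths.square[of X u p1 q p2 v] assms(2) p by simp
  moreover have "lab (left_side X q) = y" "lab (top_side X q) = x"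
    using q p lab_eq parallel_left_right parallel.opposite square_sides by metis+
  ultimately show ?thesis using p swap by fastforce
next
  case (cancel w1 x w2)
  then obtain p1 a b p2 where p: "p = p1 @ [a, b] @ p2" "word p1 = w1" "lab a = x"
    "lab b = inv_lab x" "word p2 = w2"
    by (auto simp: map_eq_append_conv map_eq_Cons_conv)
  then have ab: "a \<in> oriented_edges X" "b \<in> oriented_edges X" "tgt X a = src X b"
    using assms(2) by (auto simp: edge_path_append)
  then have "b = rev_edge X a" using edge_unique edge_rev inv_lab p by metis
  then have "homotopic_edge_paths X u v p (p1 @ p2)"
    using homotopic_edge_paths.backtrack[of X u p1 a p2 v] assms(2) p by simp
  then show ?thesis using p cancel by auto
qed

lemma lift_red:
  assumes "red (word p) w" "edge_path X u p v"
  shows "\<exists>p'. homotopic_edge_paths X u v p p' \<and> word p' = w"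
  using assms(1)
proof (induction rule: rtranclp_induct)
  case base
  show ?case using homotopic_edge_paths.refl[OF assms(2)] by blast
next
  case (step w w')
  then show ?case using lift_step homotopic_paths homotopic_edge_paths.trans by metis
qed

text \<open>Words with the same normal form lift to homotopies from both paths to paths that read
  this normal form; these coincide, because a word and a starting vertex determine the path.\<close>

lemma homotopic_iff:
  assumes "edge_path X u p v" "edge_path X u p' v"
  shows "homotopic_edge_paths X u v p p' \<longleftrightarrow> eqv (word p) (word p')"
proof
  assume "eqv (word p) (word p')"
  then have "red (word p) (nf (word p'))"
    using red_nf teq_imp_red unfolding eqv_def by (meson rtranclp_trans)
  then obtain r where r: "homotopic_edge_paths X u v p r" "word r = nf (word p')"
    using lift_red assms by blast
  obtain r' where r': "homotopic_edge_paths X u v p' r'" "word r' = nf (word p')"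
    using lift_red[OF red_nf] assms by blast
  have "r = r'" using r r' homotopic_paths edge_path_unique by metis
  then show "homotopic_edge_paths X u v p p'"
    using r(1) r'(1) homotopic_edge_paths.sym homotopic_edge_paths.trans by metis
qed (rule homotopic_imp_eqv)

lemma short_conjugating_loop:
  assumes "edge_path X v p v" "edge_path X v q v" "edge_path X v g v"
    and "homotopic_edge_paths X v v (p @ g) (g @ q)"
  shows "\<exists>g'. edge_path X v g' v \<and> homotopic_edge_paths X v v (p @ g') (g' @ q) \<and>
    length g' \<le> (conj_const + 1) * (length p + length q) + card (vertices X)"
proof -
  have v: "v \<in> vertices X" using edge_path_vertices assms(1) by blast
  have "eqv (word p @ word g) (word g @ word q)"
    using homotopic_imp_eqv[OF assms(4)] by simp
  then obtain w where w: "run v w v" "eqv (word p @ w) (w @ word q)"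
    "length w \<le> (conj_const + 1) * (length (word p) + length (word q)) + card (vertices X)"
    using short_conjugator[OF v] assms edge_path_run by meson
  obtain g' where g': "edge_path X v g' v" "word g' = w" using run_edge_path w(1) v by blast
  have "homotopic_edge_paths X v v (p @ g') (g' @ q)"
    using homotopic_iff[of v "p @ g'" v "g' @ q"] g' w(2) assms edge_path_append by auto
  then show ?thesis using g' w(3) by auto
qed

end


section \<open>Word length\<close>

locale finitely_generated_group = group G for G :: "('g, 'm) monoid_scheme" (structure) +
  fixes S :: "'g set"
  assumes finite_S: "finite S" and S_carrier: "S \<subseteq> carrier G"
    and generate_S: "generate G S = carrier G"
begin

abbreviation letters :: "'g set" where
  "letters \<equiv> S \<union> m_inv G ` S"

abbreviation value_of :: "'g list \<Rightarrow> 'g" where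
  "value_of ws \<equiv> foldr (mult G) ws \<one>"

abbreviation len :: "'g \<Rightarrow> nat" where
  "len \<equiv> word_length G S"

lemma letters_carrier: "letters \<subseteq> carrier G"
  using S_carrier by auto

lemma value_of_closed: "set ws \<subseteq> letters \<Longrightarrow> value_of ws \<in> carrier G"
  by (induction ws) (use letters_carrier in auto)

lemma value_of_append:
  "set us \<subseteq> letters \<Longrightarrow> set ws \<subseteq> letters \<Longrightarrow> value_of (us @ ws) = value_of us \<otimes> value_of ws"
proof (induction us)
  case (Cons x us)
  then have "x \<in> carrier G" using letters_carrier by auto
  then show ?case using Cons value_of_closed by (simp add: m_assoc)
qed (simp add: value_of_closed)

lemma len_value_of: "set ws \<subseteq> letters \<Longrightarrow> len (value_of ws) \<le> length ws"
  unfolding word_length_def by (rule Least_le) blast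

lemma ex_word:
  assumes "g \<in> carrier G" shows "\<exists>ws. set ws \<subseteq> letters \<and> value_of ws = g"
proof -
  have "g \<in> generate G S" using assms generate_S by simp
  then show ?thesis
  proof induction
    case one
    show ?case by (rule exI[of _ "[]"]) simp
  next
    case (incl h)
    then show ?case using S_carrier by (intro exI[of _ "[h]"]) auto
  next
    case (inv h)
    then show ?case using S_carrier by (intro exI[of _ "[inv h]"]) auto
  next
    case (eng h1 h2)
    then obtain us ws where "set us \<subseteq> letters" "value_of us = h1" "set ws \<subseteq> letters" "value_of ws = h2"
      by blast
    then show ?case
      using value_of_append[of us ws] by (intro exI[of _ "us @ ws"]) (simp del: foldr_append)
  qed
qed

lemma shortest_word:
  assumes "g \<in> carrier G"
  obtains ws where "set ws \<subseteq> letters" "value_of ws = g" "length ws = len g"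
proof -
  have "\<exists>n ws. length ws = n \<and> set ws \<subseteq> letters \<and> value_of ws = g" using ex_word[OF assms] by blast
  then have "\<exists>ws. length ws = len g \<and> set ws \<subseteq> letters \<and> value_of ws = g"
    unfolding word_length_def by (rule LeastI_ex)
  then show thesis using that by blast
qed

lemma len_mult:
  assumes "x \<in> carrier G" "y \<in> carrier G" shows "len (x \<otimes> y) \<le> len x + len y"
proof -
  obtain us where us: "set us \<subseteq> letters" "value_of us = x" "length us = len x"
    using shortest_word assms by blast
  obtain ws where ws: "set ws \<subseteq> letters" "value_of ws = y" "length ws = len y"
    using shortest_word assms by blast
  have "len (value_of (us @ ws)) \<le> length (us @ ws)" using us ws by (intro len_value_of) simp
  then show ?thesis using us ws value_of_append[of us ws] by (simp del: foldr_append)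
qed

lemma len_pow: "x \<in> carrier G \<Longrightarrow> len (x [^] (n :: nat)) \<le> n * len x"
proof (induction n)
  case 0
  then show ?case using len_value_of[of "[]"] by simp
next
  case (Suc n)
  then show ?case using len_mult[of "x [^] n" x] by simp
qed

end


section \<open>Subgroups of finite index\<close>

context group
begin

lemma pow_conj:
  assumes "r \<in> carrier G" "k \<in> carrier G" "a \<in> carrier G" "r \<otimes> a = k \<otimes> r"
  shows "r \<otimes> a [^] (n :: nat) = k [^] n \<otimes> r"
proof (induction n)
  case (Suc n)
  have "r \<otimes> a [^] Suc n = (r \<otimes> a [^] n) \<otimes> a" using assms by (simp add: m_assoc)
  also have "\<dots> = k [^] n \<otimes> (r \<otimes> a)" using Suc assms by (simp add: m_assoc)
  also have "\<dots> = k [^] Suc n \<otimes> r" using assms by (simp add: m_assoc)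
  finally show ?case .
qed (use assms in simp)

text \<open>Finite index is given by cosets \<open>H #> a\<close>; inverting their representatives
  yields representatives for the cosets on the other side.\<close>

lemma left_transversal:
  assumes H: "subgroup H G" and fin: "finite (rcosets H)"
  obtains R where "finite R" "R \<subseteq> carrier G"
    "\<And>g. g \<in> carrier G \<Longrightarrow> \<exists>r\<in>R. \<exists>h\<in>H. g = r \<otimes> h"
proof -
  define c where "c A = (SOME a. a \<in> A)" for A :: "'a set"
  have c: "c A \<in> A" if A: "A \<in> rcosets H" for A
  proof -
    obtain a where "a \<in> carrier G" "A = H #> a"
      using A unfolding RCOSETS_def by blast
    then have "a \<in> A" using rcos_self[of a H] H by simp
    then show ?thesis unfolding c_def some_in_eq by blast
  qed
  have sub: "A \<subseteq> carrier G" if "A \<in> rcosets H" for A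
    using subgroup.rcosets_carrier[OF H is_group that] .
  define R where "R = m_inv G ` c ` (rcosets H)"
  have "\<exists>r\<in>R. \<exists>h\<in>H. g = r \<otimes> h" if g: "g \<in> carrier G" for g
  proof -
    have A: "H #> inv g \<in> rcosets H" by (rule rcosetsI[OF subgroup.subset[OF H] inv_closed[OF g]])
    then obtain h where h: "h \<in> H" "c (H #> inv g) = h \<otimes> inv g"
      using c[OF A] unfolding r_coset_def by blast
    have hc: "h \<in> carrier G" by (rule subgroup.mem_carrier[OF H h(1)])
    have "g = inv (c (H #> inv g)) \<otimes> h"
      unfolding h(2) using g hc by (simp add: inv_mult_group m_assoc)
    then show ?thesis using A h(1) unfolding R_def by blast
  qed
  moreover have "finite R" using fin by (simp add: R_def)
  moreover have "R \<subseteq> carrier G"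
  proof
    fix r assume "r \<in> R"
    then obtain A where "A \<in> rcosets H" "r = inv (c A)" unfolding R_def by blast
    then show "r \<in> carrier G" using c[of A] sub[of A] inv_closed by blast
  qed
  ultimately show thesis using that by blast
qed

text \<open>Among the exponents up to \<open>card R\<close> two give powers with the same
  representative, so some \<open>g [^] d\<close> with \<open>0 < d \<le> card R\<close> lies in
  \<open>H\<close>. The factorial is a multiple of every such \<open>d\<close> and so does not
  depend on \<open>g\<close>.\<close>

lemma power_in_finite_index:
  assumes H: "subgroup H G" and R: "finite R" "R \<subseteq> carrier G"
    "\<And>g. g \<in> carrier G \<Longrightarrow> \<exists>r\<in>R. \<exists>h\<in>H. g = r \<otimes> h"
    and g: "g \<in> carrier G"
  shows "g [^] (fact (card R) :: nat) \<in> H"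
proof -
  have "\<forall>i. \<exists>r h. r \<in> R \<and> h \<in> H \<and> g [^] (i :: nat) = r \<otimes> h" using R(3) g by (meson nat_pow_closed)
  then obtain r h where rh: "\<And>i. r i \<in> R" "\<And>i. h i \<in> H" "\<And>i. g [^] (i :: nat) = r i \<otimes> h i" by metis
  have "card (r ` {..card R}) \<le> card R" using rh(1) R(1) by (intro card_mono) auto
  then have "\<not> inj_on r {..card R}" using card_image[of r "{..card R}"] by auto
  then obtain i j where ij: "i < j" "j \<le> card R" "r i = r j"
    unfolding inj_on_def by (metis atMost_iff linorder_neqE_nat)
  define d where "d = j - i"
  have hc: "h n \<in> carrier G" "r n \<in> carrier G" for n
    using rh[of n] R(2) subgroup.mem_carrier[OF H] by blast+
  have "r i \<otimes> h j = g [^] (i + d)" using ij rh(3)[of j] by (simp add: d_def)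
  also have "\<dots> = r i \<otimes> (h i \<otimes> g [^] d)"
    using g hc by (simp add: nat_pow_mult[symmetric] rh(3)[of i] m_assoc)
  finally have "h j = h i \<otimes> g [^] d" using hc g by simp
  then have "g [^] d = inv (h i) \<otimes> h j" using hc g by (simp add: inv_solve_left)
  then have d: "g [^] d \<in> H" using H rh(2) by (simp add: subgroup.m_closed subgroup.m_inv_closed)
  have "d dvd fact (card R)" using ij by (intro dvd_fact) (auto simp: d_def)
  then obtain k where "fact (card R) = d * k" by (auto elim: dvdE)
  then have "g [^] (fact (card R) :: nat) = (g [^] d) [^] k" using g by (simp add: nat_pow_pow)
  moreover have "(g [^] d) [^] n \<in> H" for n :: nat
    by (induction n) (use d H subgroup.m_closed subgroup.one_closed in fastforce)+
  ultimately show ?thesis by simp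
qed

end


section \<open>Comparison of word length with length of edge loops\<close>

context compact_special_complex
begin

definition rev_path :: "'q list \<Rightarrow> 'q list" where
  "rev_path p = rev (map (rev_edge X) p)"

lemma edge_path_rev: "edge_path X u p v \<Longrightarrow> edge_path X v (rev_path p) u"
  by (induction p arbitrary: u)
    (auto simp: rev_path_def edge_path_append edge_rev dest: edge_path_vertices)

lemma word_rev_path: "edge_path X u p v \<Longrightarrow> word (rev_path p) = winv (word p)"
  by (induction p arbitrary: u) (auto simp: rev_path_def inv_lab)

lemma homotopy_class_eq:
  assumes "edge_path X v p v" "edge_path X v q v"
  shows "homotopy_class X v p = homotopy_class X v q \<longleftrightarrow> homotopic_edge_paths X v v p q"
proof
  assume "homotopy_class X v p = homotopy_class X v q"
  then have "p \<in> homotopy_class X v q"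
    using homotopic_edge_paths.refl[OF assms(1)] by (auto simp: homotopy_class_def)
  then show "homotopic_edge_paths X v v p q"
    using homotopic_edge_paths.sym by (auto simp: homotopy_class_def)
next
  assume pq: "homotopic_edge_paths X v v p q"
  then show "homotopy_class X v p = homotopy_class X v q"
    unfolding homotopy_class_def
    using homotopic_edge_paths.sym[OF pq] homotopic_edge_paths.trans[of X v v] by blast
qed

lemma mult_homotopy_class:
  assumes "edge_path X v p v" "edge_path X v q v"
  shows "homotopy_class X v p \<otimes>\<^bsub>fundamental_group X v\<^esub> homotopy_class X v q =
    homotopy_class X v (p @ q)"
proof -
  have eq: "homotopy_class X v (p' @ q') = homotopy_class X v (p @ q)"
    if "p' \<in> homotopy_class X v p" "q' \<in> homotopy_class X v q" for p' q'
  proof -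
    have h: "homotopic_edge_paths X v v p p'" "homotopic_edge_paths X v v q q'"
      using that by (simp_all add: homotopy_class_def)
    then have paths: "edge_path X v (p' @ q') v" "edge_path X v (p @ q) v"
      using homotopic_paths edge_path_append by blast+
    have "eqv (word (p' @ q')) (word (p @ q))"
      using h[THEN homotopic_imp_eqv] eqv_append eqv_sym by simp
    then show ?thesis using homotopy_class_eq homotopic_iff paths by blast
  qed
  have ne: "homotopy_class X v p \<noteq> {}" "homotopy_class X v q \<noteq> {}"
    using homotopic_edge_paths.refl[OF assms(1)] homotopic_edge_paths.refl[OF assms(2)]
    by (auto simp: homotopy_class_def)
  have "homotopy_class X v p \<otimes>\<^bsub>fundamental_group X v\<^esub> homotopy_class X v q =
      (\<Union>p'\<in>homotopy_class X v p. \<Union>q'\<in>homotopy_class X v q. homotopy_class X v (p' @ q'))"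
    by (simp add: fundamental_group_def)
  also have "\<dots> = (\<Union>p'\<in>homotopy_class X v p. \<Union>q'\<in>homotopy_class X v q. homotopy_class X v (p @ q))"
    by (rule SUP_cong[OF HOL.refl SUP_cong[OF HOL.refl eq]])
  also have "\<dots> = homotopy_class X v (p @ q)" using ne by simp
  finally show ?thesis .
qed

end

section \<open>Loops that represent the elements of the finite index subgroup\<close>

locale special_subgroup = finitely_generated_group G S + compact_special_complex X
  for G :: "('g, 'm) monoid_scheme" (structure) and S :: "'g set" and X :: "'q cube_complex" +
  fixes H :: "'g set" and v :: 'q and \<phi> :: "'g \<Rightarrow> 'q list set"
  assumes subgroup_H: "subgroup H G" and finite_index: "finite (rcosets H)"
    and connected: "connected_complex X" and base: "v \<in> vertices X"
    and iso: "\<phi> \<in> iso (G\<lparr>carrier := H\<rparr>) (fundamental_group X v)"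
begin

definition represents :: "'q list \<Rightarrow> 'g \<Rightarrow> bool" where
  "represents p x \<longleftrightarrow> x \<in> H \<and> edge_path X v p v \<and> \<phi> x = homotopy_class X v p"

lemma H_carrier: "x \<in> H \<Longrightarrow> x \<in> carrier G"
  using subgroup_H subgroup.mem_carrier by fast

lemma represents_mult:
  assumes "represents p x" "represents q y" shows "represents (p @ q) (x \<otimes> y)"
proof -
  have "\<phi> (x \<otimes> y) = \<phi> x \<otimes>\<^bsub>fundamental_group X v\<^esub> \<phi> y"
    using hom_mult[of \<phi> "G\<lparr>carrier := H\<rparr>" "fundamental_group X v" x y] iso assms
    by (simp add: iso_def represents_def)
  then show ?thesis
    using assms subgroup_H edge_path_append
    by (auto simp: represents_def mult_homotopy_class subgroup.m_closed)
qed

lemma represents_eq_iff: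
  assumes "represents p x" "represents q y"
  shows "x = y \<longleftrightarrow> homotopic_edge_paths X v v p q"
proof -
  have "inj_on \<phi> H" using iso by (auto simp: iso_def bij_betw_def)
  then have "x = y \<longleftrightarrow> \<phi> x = \<phi> y"
    using assms inj_on_eq_iff[of \<phi> H x y] by (simp add: represents_def)
  then show ?thesis using assms homotopy_class_eq[of v p q] by (simp add: represents_def)
qed

lemma ex_loop:
  assumes "x \<in> H" shows "\<exists>p. represents p x"
proof -
  have "\<phi> x \<in> carrier (fundamental_group X v)"
    using iso assms by (auto simp: iso_def bij_betw_def)
  then show ?thesis using assms by (auto simp: fundamental_group_def represents_def)
qed

lemma ex_element:
  assumes "edge_path X v p v" shows "\<exists>x. represents p x"
proof -
  have "homotopy_class X v p \<in> \<phi> ` H"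
    using iso assms by (auto simp: iso_def bij_betw_def fundamental_group_def)
  then show ?thesis using assms by (auto simp: represents_def)
qed

lemma represents_homotopic:
  assumes "represents p x" "homotopic_edge_paths X v v p q" shows "represents q x"
  using assms homotopic_paths[OF assms(2)] homotopy_class_eq[of v p q]
  by (simp add: represents_def)

text \<open>Each edge is closed up to a loop by chosen paths from the base vertex. A loop is
  homotopic to the product of its closed-up edges, and there are only finitely many edges.\<close>

lemma len_le_path_length:
  obtains M C where "\<And>p x. represents p x \<Longrightarrow> len x \<le> M * length p + C"
proof -
  have "\<forall>u. \<exists>p. u \<in> vertices X \<longrightarrow> edge_path X v p u"
    using connected base unfolding connected_complex_def by blast
  then obtain \<tau>' where \<tau>': "\<And>u. u \<in> vertices X \<Longrightarrow> edge_path X v (\<tau>' u) u" by metis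
  \<comment> \<open>The empty path at \<open>v\<close> ensures that closing up does not alter a loop
    that already starts there.\<close>
  define \<tau> where "\<tau> u = (if u = v then [] else \<tau>' u)" for u
  have \<tau>: "edge_path X v (\<tau> u) u" if "u \<in> vertices X" for u
    using \<tau>' that by (auto simp: \<tau>_def)
  have "\<forall>e. \<exists>x. e \<in> oriented_edges X \<longrightarrow>
      represents (\<tau> (src X e) @ [e] @ rev_path (\<tau> (tgt X e))) x"
  proof
    fix e
    show "\<exists>x. e \<in> oriented_edges X \<longrightarrow>
      represents (\<tau> (src X e) @ [e] @ rev_path (\<tau> (tgt X e))) x"
    proof (cases "e \<in> oriented_edges X")
      case True
      then have "edge_path X v (\<tau> (src X e) @ [e] @ rev_path (\<tau> (tgt X e))) v"
        using \<tau> edge_path_rev edge_rev by (auto simp: edge_path_append)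
      then show ?thesis using ex_element by blast
    qed simp
  qed
  then obtain \<gamma> where \<gamma>: "\<And>e. e \<in> oriented_edges X \<Longrightarrow>
      represents (\<tau> (src X e) @ [e] @ rev_path (\<tau> (tgt X e))) (\<gamma> e)" by metis
  have "finite (oriented_edges X)"
    using compact by (auto simp: compact_complex_def oriented_edges_def)
  define M where "M = (\<Sum>e\<in>oriented_edges X. len (\<gamma> e))"
  have M: "len (\<gamma> e) \<le> M" if "e \<in> oriented_edges X" for e
    unfolding M_def using that \<open>finite (oriented_edges X)\<close> by (intro member_le_sum) auto
  obtain x0 where x0: "represents [] x0" using ex_element[of "[]"] base by auto
  have main: "\<exists>x. represents (\<tau> u @ q) x \<and> len x \<le> M * length q + len x0"
    if "edge_path X u q v" for u q
    using that
  proof (induction q arbitrary: u)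
    case Nil
    then show ?case using x0 by (intro exI[of _ x0]) (simp add: \<tau>_def)
  next
    case (Cons e q)
    define t where "t = tgt X e"
    have e: "e \<in> oriented_edges X" "src X e = u" "edge_path X t q v"
      using Cons.prems by (simp_all add: t_def)
    have ut: "u \<in> vertices X" "t \<in> vertices X" using e edge_path_vertices Cons.prems by blast+
    obtain x where x: "represents (\<tau> t @ q) x" "len x \<le> M * length q + len x0"
      using Cons.IH e(3) by blast
    let ?l = "\<tau> u @ [e] @ rev_path (\<tau> t)"
    have l: "represents (?l @ \<tau> t @ q) (\<gamma> e \<otimes> x)"
      using represents_mult[OF \<gamma>[OF e(1)] x(1)] e(2) by (simp add: t_def)
    have uq: "edge_path X v (\<tau> u @ e # q) v"
      using \<tau> ut Cons.prems edge_path_append by blast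
    have "eqv (word ((\<tau> u @ [e]) @ (rev_path (\<tau> t) @ \<tau> t) @ q)) (word ((\<tau> u @ [e]) @ [] @ q))"
      using word_rev_path[OF \<tau>[OF ut(2)]]
      by (simp only: map_append list.map) (intro eqv_context, simp add: eqv_winv_left)
    then have "homotopic_edge_paths X v v (?l @ \<tau> t @ q) (\<tau> u @ e # q)"
      using homotopic_iff[of v "?l @ \<tau> t @ q" v "\<tau> u @ e # q"] l uq by (simp add: represents_def)
    then have "represents (\<tau> u @ e # q) (\<gamma> e \<otimes> x)" using represents_homotopic l by blast
    moreover have "len (\<gamma> e \<otimes> x) \<le> M * length (e # q) + len x0"
    proof -
      have "len (\<gamma> e \<otimes> x) \<le> len (\<gamma> e) + len x"
        using \<gamma>[OF e(1)] x(1) H_carrier by (intro len_mult) (auto simp: represents_def)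
      then show ?thesis using M[OF e(1)] x(2) by simp
    qed
    ultimately show ?case by blast
  qed
  have "len x \<le> M * length p + len x0" if p: "represents p x" for p x
  proof -
    obtain y where y: "represents (\<tau> v @ p) y" "len y \<le> M * length p + len x0"
      using main[of v p] p by (auto simp: represents_def)
    have "homotopic_edge_paths X v v p p"
      using p homotopic_edge_paths.refl[of X v p v] by (simp add: represents_def)
    then have "y = x" using represents_eq_iff[OF y(1) p] by (simp add: \<tau>_def)
    then show ?thesis using y by simp
  qed
  then show thesis using that by blast
qed

text \<open>This is Reidemeister-Schreier rewriting: as letters are multiplied on the left, the
  coset representative stays in \<open>R\<close>, and each letter \<open>s\<close> contributes the
  \<open>H\<close>-part of some \<open>s \<otimes> r\<close>, which ranges over a finite
  set.\<close>

lemma path_length_le_len: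
  obtains M C where "\<And>x. x \<in> H \<Longrightarrow> \<exists>p. represents p x \<and> length p \<le> M * len x + C"
proof -
  obtain R where R: "finite R" "R \<subseteq> carrier G"
    "\<And>g. g \<in> carrier G \<Longrightarrow> \<exists>r\<in>R. \<exists>h\<in>H. g = r \<otimes> h"
    using left_transversal[OF subgroup_H finite_index] by blast
  have dec: "\<exists>r h p. r \<in> R \<and> represents p h \<and> g = r \<otimes> h" if "g \<in> carrier G" for g
    using R(3)[OF that] ex_loop by blast
  then obtain \<rho> \<eta> \<pi> where \<rho>: "\<And>g. g \<in> carrier G \<Longrightarrow>
      \<rho> g \<in> R \<and> represents (\<pi> g) (\<eta> g) \<and> g = \<rho> g \<otimes> \<eta> g" by metis
  obtain \<pi>' where \<pi>': "\<And>x. x \<in> H \<Longrightarrow> represents (\<pi>' x) x" using ex_loop by metis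
  define M where "M = (\<Sum>(s, r)\<in>letters \<times> R. length (\<pi> (s \<otimes> r)))"
  define C where "C = (\<Sum>r\<in>R. length (\<pi>' r))"
  have fin: "finite (letters \<times> R)" using finite_S R(1) by simp
  have M: "length (\<pi> (s \<otimes> r)) \<le> M" if "s \<in> letters" "r \<in> R" for s r
    unfolding M_def
    using member_le_sum[OF _ _ fin, of "(s, r)" "\<lambda>(s, r). length (\<pi> (s \<otimes> r))"] that by auto
  have C: "length (\<pi>' r) \<le> C" if "r \<in> R" for r
    unfolding C_def using that R(1) by (intro member_le_sum) auto
  have main: "\<exists>r h p. r \<in> R \<and> represents p h \<and> value_of ws = r \<otimes> h \<and>
      length p \<le> M * length ws + length (\<pi> \<one>)" if "set ws \<subseteq> letters" for ws
    using that
  proof (induction ws)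
    case Nil
    then show ?case using \<rho>[OF one_closed] by force
  next
    case (Cons s ws)
    then obtain r h p where r: "r \<in> R" "represents p h" "value_of ws = r \<otimes> h"
      "length p \<le> M * length ws + length (\<pi> \<one>)" by auto
    have s: "s \<in> letters" using Cons.prems by simp
    have c: "s \<in> carrier G" "r \<in> carrier G" "h \<in> carrier G"
      using s letters_carrier r R(2) H_carrier unfolding represents_def by blast+
    then have sr_carrier: "s \<otimes> r \<in> carrier G" by simp
    note sr = \<rho>[OF sr_carrier]
    have c': "\<rho> (s \<otimes> r) \<in> carrier G" "\<eta> (s \<otimes> r) \<in> carrier G"
      using sr R(2) H_carrier by (auto simp: represents_def)
    have "value_of (s # ws) = (s \<otimes> r) \<otimes> h" using r(3) c by (simp add: m_assoc)
    also have "\<dots> = \<rho> (s \<otimes> r) \<otimes> \<eta> (s \<otimes> r) \<otimes> h" using sr by simp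
    also have "\<dots> = \<rho> (s \<otimes> r) \<otimes> (\<eta> (s \<otimes> r) \<otimes> h)" using c' c by (simp add: m_assoc)
    finally have "value_of (s # ws) = \<rho> (s \<otimes> r) \<otimes> (\<eta> (s \<otimes> r) \<otimes> h)" .
    moreover have "represents (\<pi> (s \<otimes> r) @ p) (\<eta> (s \<otimes> r) \<otimes> h)"
      using sr r(2) represents_mult by blast
    moreover have "length (\<pi> (s \<otimes> r) @ p) \<le> M * length (s # ws) + length (\<pi> \<one>)"
      using M[OF s r(1)] r(4) by simp
    ultimately show ?case using sr by blast
  qed
  have "\<exists>p. represents p x \<and> length p \<le> M * len x + (C + length (\<pi> \<one>))" if x: "x \<in> H" for x
  proof -
    obtain ws where ws: "set ws \<subseteq> letters" "value_of ws = x" "length ws = len x"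
      using shortest_word H_carrier x by blast
    obtain r h p where r: "r \<in> R" "represents p h" "x = r \<otimes> h"
      "length p \<le> M * len x + length (\<pi> \<one>)"
      using main[OF ws(1)] ws by auto
    have h: "h \<in> H" using r(2) by (simp add: represents_def)
    \<comment> \<open>The last representative lies in \<open>H\<close> as well, so it has a loop of
      its own, whose length is bounded by \<open>C\<close>.\<close>
    then have "r = x \<otimes> inv h"
      using r(1,3) R(2) H_carrier by (auto simp: m_assoc)
    then have "r \<in> H" using x h subgroup_H by (simp add: subgroup.m_closed subgroup.m_inv_closed)
    then have "represents (\<pi>' r @ p) x" using \<pi>' r represents_mult by blast
    moreover have "length (\<pi>' r @ p) \<le> M * len x + (C + length (\<pi> \<one>))"
      using C[OF r(1)] r(4) by simp
    ultimately show ?thesis by blast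
  qed
  then show thesis using that by blast
qed

lemma short_conjugator_in_H:
  assumes "represents p A" "represents q B" "k \<in> H" "k \<otimes> A = B \<otimes> k"
  shows "\<exists>k' r. represents r k' \<and> k' \<otimes> A = B \<otimes> k' \<and>
    length r \<le> (conj_const + 1) * (length q + length p) + card (vertices X)"
proof -
  obtain g where g: "represents g k" using ex_loop assms(3) by blast
  have "homotopic_edge_paths X v v (q @ g) (g @ p)"
    using represents_eq_iff[OF represents_mult[OF assms(2) g] represents_mult[OF g assms(1)]]
      assms(4) by simp
  then obtain r where r: "edge_path X v r v" "homotopic_edge_paths X v v (q @ r) (r @ p)"
    "length r \<le> (conj_const + 1) * (length q + length p) + card (vertices X)"
    using short_conjugating_loop[of v q p g] assms(1,2) g by (auto simp: represents_def)
  obtain k' where k': "represents r k'" using ex_element r(1) by blast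
  have "B \<otimes> k' = k' \<otimes> A"
    using represents_eq_iff[OF represents_mult[OF assms(2) k'] represents_mult[OF k' assms(1)]] r(2)
    by simp
  then show ?thesis using k' r(3) by metis
qed

theorem linear_conjugator:
  "\<exists>K C N :: nat. N > 0 \<and> (\<forall>a\<in>carrier G. \<forall>b\<in>carrier G. conjugate_in G a b \<longrightarrow>
     (\<exists>g\<in>carrier G. g \<otimes> a [^] N = b [^] N \<otimes> g \<and> len g \<le> K * (len a + len b) + C))"
proof -
  obtain R where R: "finite R" "R \<subseteq> carrier G"
    "\<And>g. g \<in> carrier G \<Longrightarrow> \<exists>r\<in>R. \<exists>h\<in>H. g = r \<otimes> h"
    using left_transversal[OF subgroup_H finite_index] by blast
  define N :: nat where "N = fact (card R)"
  have N: "g [^] N \<in> H" if "g \<in> carrier G" for g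
    unfolding N_def using power_in_finite_index[OF subgroup_H R that] .
  define c where "c = (\<Sum>r\<in>R. len r + len (inv r))"
  have c: "len r + len (inv r) \<le> c" if "r \<in> R" for r
    unfolding c_def using that R(1) by (intro member_le_sum[of r R "\<lambda>r. len r + len (inv r)"]) auto
  obtain M1 C1 where 1: "\<And>p x. represents p x \<Longrightarrow> len x \<le> M1 * length p + C1"
    using len_le_path_length by blast
  obtain M2 C2 where 2: "\<And>x. x \<in> H \<Longrightarrow> \<exists>p. represents p x \<and> length p \<le> M2 * len x + C2"
    using path_length_le_len by blast
  define M3 where "M3 = conj_const + 1"
  define K where "K = M1 * M3 * M2 * N"
  define C where "C = c + M1 * (M3 * (M2 * N * c + 2 * C2) + card (vertices X)) + C1"
  have "\<exists>g\<in>carrier G. g \<otimes> a [^] N = b [^] N \<otimes> g \<and> len g \<le> K * (len a + len b) + C"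
    if a: "a \<in> carrier G" and b: "b \<in> carrier G" and conj: "conjugate_in G a b" for a b
  proof -
    obtain h where h: "h \<in> carrier G" "h \<otimes> a \<otimes> inv h = b"
      using conj by (auto simp: conjugate_in_def)
    obtain r k where r: "r \<in> R" "k \<in> H" "h = r \<otimes> k" using R(3)[OF h(1)] by blast
    have rc: "r \<in> carrier G" and kc: "k \<in> carrier G" using r R(2) H_carrier by auto
    \<comment> \<open>The factor \<open>r\<close> of the conjugator comes from a finite set and is
      absorbed into \<open>b\<close>. What remains is conjugation by \<open>k\<close> in
      \<open>H\<close>; the elements \<open>a\<close> and \<open>b'\<close> are brought into
      \<open>H\<close> by taking \<open>N\<close>-th powers.\<close>
    define b' where "b' = inv r \<otimes> (b \<otimes> r)"
    have b': "b' \<in> carrier G" using b rc by (simp add: b'_def)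
    have rb: "r \<otimes> b' = b \<otimes> r" using b rc by (simp add: b'_def m_assoc[symmetric])
    have "b \<otimes> (r \<otimes> k) = r \<otimes> k \<otimes> a" using h r(3) a by (auto simp: m_assoc)
    then have "k \<otimes> a = b' \<otimes> k" using rc kc a b by (simp add: b'_def m_assoc inv_solve_left)
    then have "k \<otimes> a [^] N = b' [^] N \<otimes> k" by (rule pow_conj[OF kc b' a])
    moreover obtain p where p: "represents p (a [^] N)" "length p \<le> M2 * len (a [^] N) + C2"
      using 2 N a by blast
    moreover obtain q where q: "represents q (b' [^] N)" "length q \<le> M2 * len (b' [^] N) + C2"
      using 2 N b' by blast
    ultimately obtain k' s where s: "represents s k'" "k' \<otimes> a [^] N = b' [^] N \<otimes> k'"
      "length s \<le> M3 * (length q + length p) + card (vertices X)"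
      using short_conjugator_in_H r(2) unfolding M3_def by blast
    have k'c: "k' \<in> carrier G" using s(1) H_carrier by (simp add: represents_def)
    have rbN: "r \<otimes> b' [^] N = b [^] N \<otimes> r" by (rule pow_conj[OF rc b b' rb])
    have "(r \<otimes> k') \<otimes> a [^] N = r \<otimes> (b' [^] N \<otimes> k')" using s(2) rc k'c a by (simp add: m_assoc)
    also have "\<dots> = (r \<otimes> b' [^] N) \<otimes> k'" using rc k'c b' by (simp add: m_assoc)
    also have "\<dots> = b [^] N \<otimes> (r \<otimes> k')" unfolding rbN using rc k'c b by (simp add: m_assoc)
    finally have eq: "(r \<otimes> k') \<otimes> a [^] N = b [^] N \<otimes> (r \<otimes> k')" .
    have "len b' \<le> len b + c"
      using len_mult[of "inv r" "b \<otimes> r"] len_mult[of b r] c[OF r(1)] b rc by (simp add: b'_def)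
    then have "len (b' [^] N) \<le> N * (len b + c)"
      using len_pow[OF b', of N] by (meson le_trans mult_le_mono2)
    then have lq: "length q \<le> M2 * (N * (len b + c)) + C2"
      using q(2) by (meson add_le_mono1 le_trans mult_le_mono2)
    have lp: "length p \<le> M2 * (N * len a) + C2"
      using p(2) len_pow[OF a, of N] by (meson add_le_mono1 le_trans mult_le_mono2)
    have "length s \<le> M3 * (M2 * (N * (len b + c)) + C2 + (M2 * (N * len a) + C2)) + card (vertices X)"
      using s(3) lq lp by (meson add_le_mono add_le_mono1 le_trans mult_le_mono2)
    then have "len k' \<le> M1 * (M3 * (M2 * (N * (len b + c)) + C2 + (M2 * (N * len a) + C2)) +
        card (vertices X)) + C1"
      using 1[OF s(1)] by (meson add_le_mono1 le_trans mult_le_mono2)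
    moreover have "len (r \<otimes> k') \<le> c + len k'"
      using len_mult[OF rc k'c] c[OF r(1)] by simp
    moreover have "c + (M1 * (M3 * (M2 * (N * (len b + c)) + C2 + (M2 * (N * len a) + C2)) +
        card (vertices X)) + C1) = K * (len a + len b) + C"
      by (simp add: K_def C_def algebra_simps)
    ultimately have "len (r \<otimes> k') \<le> K * (len a + len b) + C" by linarith
    then show ?thesis using eq rc k'c by (intro bexI[of _ "r \<otimes> k'"]) simp_all
  qed
  moreover have "N > 0" by (simp add: N_def)
  ultimately show ?thesis by blast
qed

end

theorem mainTheorem3:
  fixes G :: "('g, 'm) monoid_scheme" and S :: "'g set"
  assumes "group G"
    and "virtually_compact_special G"
    and "finite S" and "S \<subseteq> carrier G" and "generate G S = carrier G"
  shows "\<exists>(K :: real) (C :: real) (N :: nat). N > 0 \<and>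
    (\<forall>a\<in>carrier G. \<forall>b\<in>carrier G.
       group.ord G a = 0 \<longrightarrow> group.ord G b = 0 \<longrightarrow> conjugate_in G a b \<longrightarrow>
       (\<exists>g\<in>carrier G. g \<otimes>\<^bsub>G\<^esub> (a [^]\<^bsub>G\<^esub> N) = (b [^]\<^bsub>G\<^esub> N) \<otimes>\<^bsub>G\<^esub> g \<and>
          real (word_length G S g) \<le>
            K * (real (word_length G S a) + real (word_length G S b)) + C))"
proof -
  obtain H and X :: "nat cube_complex" and v \<phi> where
    "subgroup H G" "finite (rcosets\<^bsub>G\<^esub> H)" "special X" "compact_complex X" "connected_complex X"
    "v \<in> vertices X" "\<phi> \<in> iso (G\<lparr>carrier := H\<rparr>) (fundamental_group X v)"
    using assms(2) unfolding virtually_compact_special_def compact_special_group_def is_iso_def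
    by blast
  then interpret special_subgroup G S X H v \<phi>
    by (intro special_subgroup.intro finitely_generated_group.intro
        finitely_generated_group_axioms.intro compact_special_complex.intro
        special_subgroup_axioms.intro assms)
  obtain K C N :: nat where N: "N > 0" and KC: "\<And>a b. a \<in> carrier G \<Longrightarrow> b \<in> carrier G \<Longrightarrow>
      conjugate_in G a b \<Longrightarrow> \<exists>g\<in>carrier G. g \<otimes>\<^bsub>G\<^esub> (a [^]\<^bsub>G\<^esub> N) = (b [^]\<^bsub>G\<^esub> N) \<otimes>\<^bsub>G\<^esub> g \<and>
        len g \<le> K * (len a + len b) + C"
    using linear_conjugator by blast
  show ?thesis
  proof (rule exI[of _ "real K"], rule exI[of _ "real C"], rule exI[of _ N],
      intro conjI ballI impI)
    fix a b assume "a \<in> carrier G" "b \<in> carrier G" "conjugate_in G a b"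
    then obtain g where g: "g \<in> carrier G" "g \<otimes>\<^bsub>G\<^esub> (a [^]\<^bsub>G\<^esub> N) = (b [^]\<^bsub>G\<^esub> N) \<otimes>\<^bsub>G\<^esub> g"
      "len g \<le> K * (len a + len b) + C"
      using KC by blast
    have "real (len g) \<le> real K * (real (len a) + real (len b)) + real C"
      using of_nat_mono[OF g(3), where 'a = real] by simp
    then show "\<exists>g\<in>carrier G. g \<otimes>\<^bsub>G\<^esub> (a [^]\<^bsub>G\<^esub> N) = (b [^]\<^bsub>G\<^esub> N) \<otimes>\<^bsub>G\<^esub> g \<and>
        real (len g) \<le> real K * (real (len a) + real (len b)) + real C"
      using g by blast
  qed (rule N)
qed

end
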